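(* Let $G$ be any group and $V$ a finite-dimensional real representation of $G$ with basis $t_1,\dots,t_n$ (as a vector space). Then the sequence of symmetric powers $(\mathrm{Sym}^i(V))_{i\ge0}$ and the sequence of exterior powers $(\Lambda^i(V))_{i\ge0}$ are equivariantly log-concave. Furthermore, the required injective maps are given by the equivariant Lefschetz operators: for every $i\ge 1$, the linear maps $$L=\sum_{k=1}^n t_k\otimes\frac{\partial}{\partial t_k}:\ \mathrm{Sym}^{i-1}(V)\otimes \mathrm{Sym}^{i+1}(V)\to \mathrm{Sym}^{i}(V)\otimes \mathrm{Sym}^{i}(V)$$ and $$L=\sum_{k=1}^n e_{t_k}\otimes i_{t_k^*}:\ \Lambda^{i-1}(V)\otimes\Lambda^{i+1}(V)\to\Lambda^{i}(V)\otimes\Lambda^{i}(V)$$ are injective and $G$-equivariant.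
   Context: A sequence of finite-dimensional representations $V_0,V_1,\dots$ of a group $G$ is equivariantly log-concave if, for all $i\ge1$, $V_{i-1}\otimes V_{i+1}$ is isomorphic to a subrepresentation of $V_i\otimes V_i$. The symmetric algebra $\mathrm{Sym}(V)$ is identified with the polynomial ring $\mathbb{R}[t_1,\dots,t_n]$; in the first map $t_k$ acts by multiplication on the first factor and $\partial/\partial t_k$ by differentiation on the second. In the second map $(e_{t_k}\otimes i_{t_k^*})(u\otimes w)=(t_k\wedge u)\otimes i_{t_k^*}(w)$ (no extra sign), where $t_1^*,\dots,t_n^*$ is the basis of $V^*$ dual to $t_1,\dots,t_n$, and $i_\alpha$ for $\alpha\in V^*$ is the interior product on $\Lambda(V)$: the degree $-1$ anti-derivation with $i_\alpha(v)=\alpha(v)$ for $v\in V$, $i_\alpha(u\wedge v)=(i_\alpha u)\wedge v+(-1)^{\deg u}u\wedge i_\alpha v$, and $i_\alpha=0$ on scalars. *)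

theory Defs
  imports "HOL-Analysis.Finite_Function_Topology" "HOL-Algebra.Group"
begin

section \<open>Finitely supported functions as free vector spaces\<close>

definition lin_ext :: "('k \<Rightarrow> 'a::real_vector) \<Rightarrow> ('k \<Rightarrow>\<^sub>0 real) \<Rightarrow> 'a"
  where "lin_ext f p = (\<Sum>k\<in>Poly_Mapping.keys p. Poly_Mapping.lookup p k *\<^sub>R f k)"

lemma lookup_scaleR [simp]:
  fixes p :: "'k \<Rightarrow>\<^sub>0 'b::real_vector"
  shows "Poly_Mapping.lookup (c *\<^sub>R p) k = c *\<^sub>R Poly_Mapping.lookup p k"
proof -
  have "finite {k. c *\<^sub>R Poly_Mapping.lookup p k \<noteq> 0}"
    by (rule finite_subset [OF _ finite_lookup [of p]]) auto
  then show ?thesis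
    by (simp add: scaleR_poly_mapping_def)
qed

lemma scaleR_single: "c *\<^sub>R Poly_Mapping.single k a = Poly_Mapping.single k (c *\<^sub>R a)"
  by (rule poly_mapping_eqI) (simp add: lookup_single when_def)

lemma lin_ext_superset:
  assumes "finite K" "Poly_Mapping.keys p \<subseteq> K"
  shows "lin_ext f p = (\<Sum>k\<in>K. Poly_Mapping.lookup p k *\<^sub>R f k)"
  unfolding lin_ext_def
  by (rule sum.mono_neutral_left) (use assms in \<open>auto simp: in_keys_iff\<close>)

lemma linear_lin_ext: "linear (lin_ext f)"
proof (rule linearI)
  fix p q :: "'a \<Rightarrow>\<^sub>0 real"
  let ?K = "Poly_Mapping.keys p \<union> Poly_Mapping.keys q"
  have "lin_ext f (p + q) = (\<Sum>k\<in>?K. Poly_Mapping.lookup (p + q) k *\<^sub>R f k)"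
    by (rule lin_ext_superset) (use keys_add [of p q] in auto)
  also have "\<dots> = (\<Sum>k\<in>?K. Poly_Mapping.lookup p k *\<^sub>R f k)
      + (\<Sum>k\<in>?K. Poly_Mapping.lookup q k *\<^sub>R f k)"
    by (simp add: lookup_add scaleR_add_left sum.distrib)
  also have "\<dots> = lin_ext f p + lin_ext f q"
    by (simp add: lin_ext_superset [of ?K])
  finally show "lin_ext f (p + q) = lin_ext f p + lin_ext f q" .
next
  fix c :: real and p :: "'a \<Rightarrow>\<^sub>0 real"
  have "lin_ext f (c *\<^sub>R p)
      = (\<Sum>k\<in>Poly_Mapping.keys p. Poly_Mapping.lookup (c *\<^sub>R p) k *\<^sub>R f k)"
    by (rule lin_ext_superset) (auto simp: in_keys_iff)
  then show "lin_ext f (c *\<^sub>R p) = c *\<^sub>R lin_ext f p"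
    by (simp add: lin_ext_def scaleR_sum_right)
qed

lemma lin_ext_single [simp]: "lin_ext f (Poly_Mapping.single k a) = a *\<^sub>R f k"
  by (simp add: lin_ext_def)

lemma poly_mapping_sum_single:
  "p = (\<Sum>k\<in>Poly_Mapping.keys p. Poly_Mapping.single k (Poly_Mapping.lookup p k))"
proof (rule poly_mapping_eqI)
  fix k
  have "(\<Sum>j\<in>Poly_Mapping.keys p. Poly_Mapping.lookup p j when j = k)
      = (\<Sum>j\<in>Poly_Mapping.keys p. if k = j then Poly_Mapping.lookup p j else 0)"
    by (rule sum.cong) (auto simp: when_def)
  then show "Poly_Mapping.lookup p k = Poly_Mapping.lookup
      (\<Sum>k\<in>Poly_Mapping.keys p. Poly_Mapping.single k (Poly_Mapping.lookup p k)) k"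
    by (simp add: lookup_sum lookup_single in_keys_iff)
qed

lemma span_singles: "span (range (\<lambda>k. Poly_Mapping.single k (1::real))) = UNIV"
proof -
  have "p \<in> span (range (\<lambda>k. Poly_Mapping.single k (1::real)))" for p :: "'a \<Rightarrow>\<^sub>0 real"
  proof (subst poly_mapping_sum_single, rule span_sum)
    fix k
    have "Poly_Mapping.lookup p k *\<^sub>R Poly_Mapping.single k (1::real)
        \<in> span (range (\<lambda>k. Poly_Mapping.single k (1::real)))"
      by (intro span_scale span_base) auto
    then show "Poly_Mapping.single k (Poly_Mapping.lookup p k)
        \<in> span (range (\<lambda>k. Poly_Mapping.single k (1::real)))"
      by (simp add: scaleR_single)
  qed
  then show ?thesis by auto
qed

lemma linear_zero_on_span:
  assumes "linear f" "\<And>x. x \<in> S \<Longrightarrow> f x = 0" "x \<in> span S"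
  shows "f x = 0"
  using linear_eq_on_span [OF assms(1) module_hom_zero, of S x] assms(2,3) by auto


section \<open>Tensor product\<close>

definition tensor_relations :: "(('a::real_vector \<times> 'b::real_vector) \<Rightarrow>\<^sub>0 real) set" where
  "tensor_relations =
     {Poly_Mapping.single (x + x', y) 1 - Poly_Mapping.single (x, y) 1
        - Poly_Mapping.single (x', y) 1 | x x' y. True} \<union>
     {Poly_Mapping.single (x, y + y') 1 - Poly_Mapping.single (x, y) 1
        - Poly_Mapping.single (x, y') 1 | x y y'. True} \<union>
     {Poly_Mapping.single (c *\<^sub>R x, y) 1 - c *\<^sub>R Poly_Mapping.single (x, y) 1 | c x y. True} \<union>
     {Poly_Mapping.single (x, c *\<^sub>R y) 1 - c *\<^sub>R Poly_Mapping.single (x, y) 1 | c x y. True}"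

lemma diff_diff_swap: "(p - q) - (p' - q') = (p - p') - (q - q' :: 'x::ab_group_add)"
  by simp

lemma equivp_diff_subspace:
  assumes "subspace S"
  shows "equivp (\<lambda>p q. p - q \<in> S)"
proof (rule equivpI)
  show "reflp (\<lambda>p q. p - q \<in> S)"
    using subspace_0 [OF assms] by (simp add: reflp_def)
  show "symp (\<lambda>p q. p - q \<in> S)"
  proof (rule sympI)
    fix p q assume "p - q \<in> S"
    from subspace_neg [OF assms this] show "q - p \<in> S" by simp
  qed
  show "transp (\<lambda>p q. p - q \<in> S)"
  proof (rule transpI)
    fix p q r assume "p - q \<in> S" "q - r \<in> S"
    from subspace_add [OF assms this] show "p - r \<in> S" by simp
  qed
qed

quotient_type (overloaded) ('a, 'b) tensor =
  "('a::real_vector \<times> 'b::real_vector) \<Rightarrow>\<^sub>0 real" / "\<lambda>p q. p - q \<in> span tensor_relations"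
  by (rule equivp_diff_subspace) simp

instantiation tensor :: (real_vector, real_vector) real_vector
begin

lift_definition zero_tensor :: "('a, 'b) tensor" is 0 .

lift_definition plus_tensor :: "('a, 'b) tensor \<Rightarrow> ('a, 'b) tensor \<Rightarrow> ('a, 'b) tensor" is "(+)"
  by (subst add_diff_add) (rule span_add)

lift_definition uminus_tensor :: "('a, 'b) tensor \<Rightarrow> ('a, 'b) tensor" is uminus
  by (subst minus_diff_minus) (rule span_neg)

lift_definition minus_tensor :: "('a, 'b) tensor \<Rightarrow> ('a, 'b) tensor \<Rightarrow> ('a, 'b) tensor" is "(-)"
proof -
  fix p p' q q' :: "('a \<times> 'b) \<Rightarrow>\<^sub>0 real"
  assume "p - p' \<in> span tensor_relations" "q - q' \<in> span tensor_relations"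
  then have "(p - p') - (q - q') \<in> span tensor_relations" by (rule span_diff)
  then show "p - q - (p' - q') \<in> span tensor_relations" by (simp only: diff_diff_swap)
qed

lift_definition scaleR_tensor :: "real \<Rightarrow> ('a, 'b) tensor \<Rightarrow> ('a, 'b) tensor" is scaleR
  by (subst scaleR_diff_right [symmetric]) (rule span_scale)

instance
  by standard (transfer; simp add: algebra_simps span_zero)+

end

lift_definition tensor :: "'a::real_vector \<Rightarrow> 'b::real_vector \<Rightarrow> ('a, 'b) tensor"
    (infixl \<open>\<otimes>\<^sub>\<real>\<close> 70)
  is "\<lambda>x y. Poly_Mapping.single (x, y) 1" .

text \<open>
  For subspaces \<open>U\<close> and \<open>W\<close> of the ambient spaces, \<open>U \<otimes> W\<close> is identified with its image in the
  tensor product of the ambient spaces; over a field this is no loss.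
\<close>

definition tensor_subspace :: "'a::real_vector set \<Rightarrow> 'b::real_vector set \<Rightarrow> ('a, 'b) tensor set"
  where "tensor_subspace U W = span {x \<otimes>\<^sub>\<real> y | x y. x \<in> U \<and> y \<in> W}"

definition tensor_map ::
  "('a::real_vector \<Rightarrow> 'c::real_vector) \<Rightarrow> ('b::real_vector \<Rightarrow> 'd::real_vector)
    \<Rightarrow> ('a, 'b) tensor \<Rightarrow> ('c, 'd) tensor"
  where "tensor_map f g = (THE h. linear h \<and> (\<forall>x y. h (x \<otimes>\<^sub>\<real> y) = f x \<otimes>\<^sub>\<real> g y))"

lemma tensor_relationI: "r \<in> tensor_relations \<Longrightarrow> p - q = r \<Longrightarrow> abs_tensor p = abs_tensor q"
  by (simp add: tensor.abs_eq_iff span_base)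

lemma tensor_add_left: "(x + x') \<otimes>\<^sub>\<real> y = x \<otimes>\<^sub>\<real> y + x' \<otimes>\<^sub>\<real> y"
  unfolding tensor.abs_eq plus_tensor.abs_eq
  by (rule tensor_relationI [OF _ diff_diff_add [symmetric]])
    (unfold tensor_relations_def, blast)

lemma tensor_add_right: "x \<otimes>\<^sub>\<real> (y + y') = x \<otimes>\<^sub>\<real> y + x \<otimes>\<^sub>\<real> y'"
  unfolding tensor.abs_eq plus_tensor.abs_eq
  by (rule tensor_relationI [OF _ diff_diff_add [symmetric]])
    (unfold tensor_relations_def, blast)

lemma tensor_scaleR_left: "(c *\<^sub>R x) \<otimes>\<^sub>\<real> y = c *\<^sub>R (x \<otimes>\<^sub>\<real> y)"
  unfolding tensor.abs_eq scaleR_tensor.abs_eq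
  by (rule tensor_relationI [OF _ refl]) (unfold tensor_relations_def, blast)

lemma tensor_scaleR_right: "x \<otimes>\<^sub>\<real> (c *\<^sub>R y) = c *\<^sub>R (x \<otimes>\<^sub>\<real> y)"
  unfolding tensor.abs_eq scaleR_tensor.abs_eq
  by (rule tensor_relationI [OF _ refl]) (unfold tensor_relations_def, blast)

lemma linear_abs_tensor: "linear abs_tensor"
  by (rule linearI) (simp_all add: plus_tensor.abs_eq scaleR_tensor.abs_eq)

lemma surj_abs_tensor: "surj abs_tensor"
  by (rule surjI [of _ rep_tensor]) (rule Quotient_abs_rep [OF Quotient_tensor])

lemma span_tensors: "span {x \<otimes>\<^sub>\<real> y | x y. True} = UNIV"
proof -
  have "abs_tensor ` range (\<lambda>k. Poly_Mapping.single k (1::real)) = {x \<otimes>\<^sub>\<real> y | x y. True}"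
    unfolding tensor.abs_eq image_image by fast
  then show ?thesis
    using linear_span_image [OF linear_abs_tensor, of "range (\<lambda>k. Poly_Mapping.single k 1)"]
    by (simp only: \<open>_ = {x \<otimes>\<^sub>\<real> y | x y. True}\<close> span_singles surj_abs_tensor)
qed

theorem tensor_universal:
  fixes b :: "'a::real_vector \<Rightarrow> 'b::real_vector \<Rightarrow> 'c::real_vector"
  assumes left: "\<And>y. linear (\<lambda>x. b x y)" and right: "\<And>x. linear (b x)"
  shows "\<exists>!h. linear h \<and> (\<forall>x y. h (x \<otimes>\<^sub>\<real> y) = b x y)"
proof (rule ex_ex1I)
  let ?F = "lin_ext (\<lambda>(x, y). b x y)"
  have lin: "linear ?F" by (rule linear_lin_ext)
  have kill: "?F p = 0" if "p \<in> span tensor_relations" for p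
    using that
    by (rule linear_zero_on_span [OF lin, rotated])
      (auto simp: tensor_relations_def linear_diff [OF lin] linear_cmul [OF lin]
        linear_add [OF left] linear_add [OF right] linear_cmul [OF left] linear_cmul [OF right])
  have eq: "?F (rep_tensor (abs_tensor p)) = ?F p" for p
  proof -
    have "rep_tensor (abs_tensor p) - p \<in> span tensor_relations"
      using Quotient_rep_abs [OF Quotient_tensor, of p] by (simp add: span_zero)
    from kill [OF this] show ?thesis by (simp add: linear_diff [OF lin])
  qed
  have "linear (\<lambda>z. ?F (rep_tensor z))"
  proof (rule linearI)
    fix z w :: "('a, 'b) tensor"
    obtain p q where "z = abs_tensor p" "w = abs_tensor q" by (metis surjD surj_abs_tensor)
    then show "?F (rep_tensor (z + w)) = ?F (rep_tensor z) + ?F (rep_tensor w)"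
      by (simp add: plus_tensor.abs_eq eq linear_add [OF lin])
  next
    fix c and z :: "('a, 'b) tensor"
    obtain p where "z = abs_tensor p" by (metis surjD surj_abs_tensor)
    then show "?F (rep_tensor (c *\<^sub>R z)) = c *\<^sub>R ?F (rep_tensor z)"
      by (simp add: scaleR_tensor.abs_eq eq linear_cmul [OF lin])
  qed
  then show "\<exists>h. linear h \<and> (\<forall>x y. h (x \<otimes>\<^sub>\<real> y) = b x y)"
    by (intro exI [of _ "\<lambda>z. ?F (rep_tensor z)"]) (simp add: tensor.abs_eq eq)
next
  fix h h'
  assume h: "linear h \<and> (\<forall>x y. h (x \<otimes>\<^sub>\<real> y) = b x y)"
    and h': "linear h' \<and> (\<forall>x y. h' (x \<otimes>\<^sub>\<real> y) = b x y)"
  show "h = h'"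
  proof (rule ext)
    fix z :: "('a, 'b) tensor"
    have "z \<in> span {x \<otimes>\<^sub>\<real> y | x y. True}" by (simp only: span_tensors UNIV_I)
    then show "h z = h' z"
      by (rule linear_eq_on_span [of h h', rotated -1]) (use h h' in auto)
  qed
qed

theorem tensor_map_ex1:
  assumes "linear f" "linear g"
  shows "\<exists>!h. linear h \<and> (\<forall>x y. h (x \<otimes>\<^sub>\<real> y) = f x \<otimes>\<^sub>\<real> g y)"
proof (rule tensor_universal [of "\<lambda>x y. f x \<otimes>\<^sub>\<real> g y"])
  show "linear (\<lambda>x. f x \<otimes>\<^sub>\<real> g y)" for y
    by (rule linearI)
      (simp_all add: tensor_add_left tensor_scaleR_left linear_add [OF assms(1)] linear_cmul [OF assms(1)])
  show "linear (\<lambda>y. f x \<otimes>\<^sub>\<real> g y)" for x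
    by (rule linearI)
      (simp_all add: tensor_add_right tensor_scaleR_right linear_add [OF assms(2)] linear_cmul [OF assms(2)])
qed

lemma
  assumes "linear f" "linear g"
  shows linear_tensor_map: "linear (tensor_map f g)"
    and tensor_map_tensor: "tensor_map f g (x \<otimes>\<^sub>\<real> y) = f x \<otimes>\<^sub>\<real> g y"
proof -
  have "linear (tensor_map f g) \<and> (\<forall>x y. tensor_map f g (x \<otimes>\<^sub>\<real> y) = f x \<otimes>\<^sub>\<real> g y)"
    unfolding tensor_map_def by (rule theI' [OF tensor_map_ex1 [OF assms]])
  then show "linear (tensor_map f g)" "tensor_map f g (x \<otimes>\<^sub>\<real> y) = f x \<otimes>\<^sub>\<real> g y"
    by simp_all
qed


section \<open>Symmetric and exterior algebra\<close>

subsection \<open>The free associative algebra on a set\<close>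

datatype 'v fmonoid = FMonoid (letters: "'v list")

instantiation fmonoid :: (type) monoid_add
begin

definition zero_fmonoid :: "'a fmonoid" where "0 = FMonoid []"

definition plus_fmonoid :: "'a fmonoid \<Rightarrow> 'a fmonoid \<Rightarrow> 'a fmonoid"
  where "x + y = FMonoid (letters x @ letters y)"

instance
  by standard (simp_all add: zero_fmonoid_def plus_fmonoid_def)

end

lemma poly_mapping_span_induct:
  fixes p :: "'k \<Rightarrow>\<^sub>0 'b::real_vector"
  assumes "\<And>k a. P (Poly_Mapping.single k a)" "P 0" "\<And>p q. P p \<Longrightarrow> P q \<Longrightarrow> P (p + q)"
  shows "P p"
proof -
  have "P (\<Sum>k\<in>K. Poly_Mapping.single k (Poly_Mapping.lookup p k))" for K
    by (induction K rule: infinite_finite_induct) (use assms in simp_all)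
  from this [of "Poly_Mapping.keys p"] show ?thesis
    unfolding poly_mapping_sum_single [symmetric] .
qed

instance poly_mapping :: (monoid_add, real_algebra) real_algebra
proof
  fix c :: real and p q :: "'a \<Rightarrow>\<^sub>0 'b"
  show "c *\<^sub>R p * q = c *\<^sub>R (p * q)"
  proof (induction p rule: poly_mapping_span_induct)
    case (1 k a)
    show ?case
      by (induction q rule: poly_mapping_span_induct)
        (simp_all add: scaleR_single mult_single distrib_left scaleR_add_right)
  qed (simp_all add: distrib_right scaleR_add_right)
  show "p * c *\<^sub>R q = c *\<^sub>R (p * q)"
  proof (induction p rule: poly_mapping_span_induct)
    case (1 k a)
    show ?case
      by (induction q rule: poly_mapping_span_induct)
        (simp_all add: scaleR_single mult_single distrib_left scaleR_add_right)
  qed (simp_all add: distrib_right scaleR_add_right)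
qed

instance poly_mapping :: (monoid_add, real_algebra_1) real_algebra_1 ..

type_synonym 'v free_algebra = "'v fmonoid \<Rightarrow>\<^sub>0 real"

definition word :: "'v list \<Rightarrow> 'v free_algebra"
  where "word vs = Poly_Mapping.single (FMonoid vs) 1"

definition two_sided_ideal :: "'a::real_algebra_1 set \<Rightarrow> 'a set"
  where "two_sided_ideal S = span {a * s * b | a s b. s \<in> S}"

definition algebra_hom :: "('a::real_algebra_1 \<Rightarrow> 'b::real_algebra_1) \<Rightarrow> bool"
  where "algebra_hom h \<longleftrightarrow> linear h \<and> h 1 = 1 \<and> (\<forall>x y. h (x * y) = h x * h y)"

text \<open>
  Dividing the free associative algebra on the set \<open>V\<close> by the ideal generated by
  \<open>linear_relations\<close> gives the tensor algebra of the vector space \<open>V\<close>.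
\<close>

definition linear_relations :: "'v::real_vector free_algebra set" where
  "linear_relations =
     {word [v + w] - word [v] - word [w] | v w. True} \<union>
     {word [c *\<^sub>R v] - c *\<^sub>R word [v] | c v. True}"

definition sym_relations :: "'v::real_vector free_algebra set" where
  "sym_relations = linear_relations \<union>
     {word [v] * word [w] - word [w] * word [v] | v w. True}"

definition ext_relations :: "'v::real_vector free_algebra set" where
  "ext_relations = linear_relations \<union> {word [v] * word [v] | v. True}"

lemma word_Nil: "word [] = 1"
  by (simp add: word_def flip: single_one zero_fmonoid_def)

lemma word_append: "word (us @ vs) = word us * word vs"
  by (simp add: word_def mult_single plus_fmonoid_def)

lemma word_Cons: "word (v # vs) = word [v] * word vs"
  using word_append [of "[v]" vs] by simp

lemma span_words: "span (range word) = UNIV"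
proof -
  have "range word = range (\<lambda>k. Poly_Mapping.single k (1::real))"
    unfolding word_def surj_def image_def by (metis fmonoid.exhaust UNIV_I)
  then show ?thesis using span_singles by metis
qed

lemma free_algebra_induct [case_names word add scale]:
  assumes "\<And>vs. P (word vs)" "\<And>p q. P p \<Longrightarrow> P q \<Longrightarrow> P (p + q)" "\<And>c p. P p \<Longrightarrow> P (c *\<^sub>R p)"
  shows "P p"
proof -
  have "p \<in> span (range word)" by (simp only: span_words UNIV_I)
  then show ?thesis
  proof (induction rule: span_induct_alt)
    case base
    show ?case using assms(3) [OF assms(1), of 0] by simp
  qed (auto intro: assms)
qed

lemma two_sided_ideal_base: "s \<in> S \<Longrightarrow> s \<in> two_sided_ideal S"
  unfolding two_sided_ideal_def
  by (rule span_base, rule CollectI, intro exI [of _ 1] exI [of _ s]) simp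

lemma two_sided_ideal_mult:
  assumes "x \<in> two_sided_ideal S"
  shows "c * x \<in> two_sided_ideal S" "x * c \<in> two_sided_ideal S"
proof -
  have *: "c * x * d \<in> two_sided_ideal S" for c d
    using assms unfolding two_sided_ideal_def
  proof (induction rule: span_induct_alt)
    case base
    show ?case by (simp add: span_zero)
  next
    case (step r y z)
    from step(1) obtain a s b where y: "y = a * s * b" "s \<in> S" by blast
    then have "c * y * d = (c * a) * s * (b * d)" by (simp add: mult.assoc)
    then have "c * y * d \<in> span {a * s * b | a s b. s \<in> S}"
      using y(2) by (intro span_base) blast
    then have "r *\<^sub>R (c * y * d) + c * z * d \<in> span {a * s * b | a s b. s \<in> S}"
      using step(2) by (intro span_add span_scale)
    then show ?case by (simp add: distrib_left distrib_right)
  qed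
  from *[of c 1] *[of 1 c] show "c * x \<in> two_sided_ideal S" "x * c \<in> two_sided_ideal S" by simp_all
qed

lemma two_sided_ideal_mult_cong:
  assumes "p - p' \<in> two_sided_ideal S" "q - q' \<in> two_sided_ideal S"
  shows "p * q - p' * q' \<in> two_sided_ideal S"
proof -
  have "p * (q - q') + (p - p') * q' \<in> two_sided_ideal S"
    using two_sided_ideal_mult [OF assms(1)] two_sided_ideal_mult [OF assms(2)]
    unfolding two_sided_ideal_def by (intro span_add)
  then show ?thesis by (simp add: algebra_simps)
qed

lemma linear_zero_on_ideal:
  fixes F :: "'v free_algebra \<Rightarrow> 'a::real_vector"
  assumes lin: "linear F" and 0: "\<And>us vs s. s \<in> S \<Longrightarrow> F (word us * s * word vs) = 0"
    and p: "p \<in> two_sided_ideal S"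
  shows "F p = 0"
proof -
  have "F (a * s * b) = 0" if "s \<in> S" for a b s
  proof (induction a rule: free_algebra_induct)
    case (word us)
    show ?case
      by (induction b rule: free_algebra_induct)
        (simp_all add: 0 [OF that] distrib_left linear_add [OF lin] linear_cmul [OF lin])
  qed (simp_all add: distrib_right linear_add [OF lin] linear_cmul [OF lin])
  then have "F x = 0" if "x \<in> {a * s * b | a s b. s \<in> S}" for x
    using that by fastforce
  then show ?thesis
    using p unfolding two_sided_ideal_def by (rule linear_zero_on_span [OF lin])
qed

definition eval_hom :: "('v \<Rightarrow> 'a::real_algebra_1) \<Rightarrow> 'v free_algebra \<Rightarrow> 'a"
  where "eval_hom f = lin_ext (\<lambda>w. prod_list (map f (letters w)))"

lemma linear_eval_hom: "linear (eval_hom f)"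
  unfolding eval_hom_def by (rule linear_lin_ext)

lemma eval_hom_word: "eval_hom f (word vs) = prod_list (map f vs)"
  by (simp add: eval_hom_def word_def)

lemma eval_hom_mult: "eval_hom f (p * q) = eval_hom f p * eval_hom f q"
proof (induction p rule: free_algebra_induct)
  case (word us)
  show ?case
  proof (induction q rule: free_algebra_induct)
    case (word vs)
    show ?case by (simp only: word_append [symmetric] eval_hom_word map_append prod_list.append)
  qed (simp_all add: distrib_left linear_add [OF linear_eval_hom] linear_cmul [OF linear_eval_hom])
qed (simp_all add: distrib_right linear_add [OF linear_eval_hom] linear_cmul [OF linear_eval_hom])

lemma eval_hom_ideal:
  assumes "\<And>s. s \<in> S \<Longrightarrow> eval_hom f s = 0" "p \<in> two_sided_ideal S"
  shows "eval_hom f p = 0"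
  by (rule linear_zero_on_ideal [OF linear_eval_hom _ assms(2)]) (simp add: eval_hom_mult assms(1))

lemma eval_hom_linear_relations:
  assumes "linear f" "s \<in> linear_relations"
  shows "eval_hom f s = 0"
  using assms(2)
  by (auto simp: linear_relations_def linear_diff [OF linear_eval_hom] eval_hom_word
      linear_cmul [OF linear_eval_hom] linear_add [OF assms(1)] linear_cmul [OF assms(1)])

lemma eval_hom_sym_relations:
  assumes "linear f" "\<And>v w. f v * f w = f w * f v" "s \<in> sym_relations"
  shows "eval_hom f s = 0"
proof -
  from assms(3) consider "s \<in> linear_relations"
    | v w where "s = word [v] * word [w] - word [w] * word [v]"
    unfolding sym_relations_def by blast
  then show ?thesis
  proof cases
    case 2
    show ?thesis
      unfolding 2 linear_diff [OF linear_eval_hom] eval_hom_mult eval_hom_word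
      using assms(2) [of v w] by simp
  qed (rule eval_hom_linear_relations [OF assms(1)])
qed

lemma eval_hom_ext_relations:
  assumes "linear f" "\<And>v. f v * f v = 0" "s \<in> ext_relations"
  shows "eval_hom f s = 0"
proof -
  from assms(3) consider "s \<in> linear_relations" | v where "s = word [v] * word [v]"
    unfolding ext_relations_def by blast
  then show ?thesis
  proof cases
    case 2
    show ?thesis
      unfolding 2 eval_hom_mult eval_hom_word using assms(2) [of v] by simp
  qed (rule eval_hom_linear_relations [OF assms(1)])
qed

lemma one_notin_ideal:
  fixes S :: "'v free_algebra set"
  assumes "\<And>s. s \<in> S \<Longrightarrow> eval_hom (\<lambda>_. 0::real) s = 0"
  shows "1 \<notin> two_sided_ideal S"
proof
  assume "1 \<in> two_sided_ideal S"
  then have "eval_hom (\<lambda>_. 0::real) (1 :: 'v free_algebra) = 0"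
    by (rule eval_hom_ideal [rotated]) (rule assms)
  then show False unfolding word_Nil [symmetric] eval_hom_word by simp
qed

lemma subspace_two_sided_ideal: "subspace (two_sided_ideal S)"
  unfolding two_sided_ideal_def by (rule subspace_span)

lemma linear_const_zero: "linear (\<lambda>_. 0)"
  by (rule linearI) simp_all


subsection \<open>The two quotients\<close>

quotient_type (overloaded) 'v sym_algebra =
  "'v::real_vector free_algebra" / "\<lambda>p q. p - q \<in> two_sided_ideal sym_relations"
  by (rule equivp_diff_subspace) (rule subspace_two_sided_ideal)

quotient_type (overloaded) 'v ext_algebra =
  "'v::real_vector free_algebra" / "\<lambda>p q. p - q \<in> two_sided_ideal ext_relations"
  by (rule equivp_diff_subspace) (rule subspace_two_sided_ideal)

instantiation sym_algebra :: (real_vector) real_algebra_1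
begin

lift_definition zero_sym_algebra :: "'a sym_algebra" is 0 .

lift_definition one_sym_algebra :: "'a sym_algebra" is 1 .

lift_definition plus_sym_algebra :: "'a sym_algebra \<Rightarrow> 'a sym_algebra \<Rightarrow> 'a sym_algebra" is "(+)"
  by (subst add_diff_add) (rule subspace_add [OF subspace_two_sided_ideal])

lift_definition uminus_sym_algebra :: "'a sym_algebra \<Rightarrow> 'a sym_algebra" is uminus
  by (subst minus_diff_minus) (rule subspace_neg [OF subspace_two_sided_ideal])

lift_definition minus_sym_algebra :: "'a sym_algebra \<Rightarrow> 'a sym_algebra \<Rightarrow> 'a sym_algebra" is "(-)"
  by (subst diff_diff_swap) (rule subspace_diff [OF subspace_two_sided_ideal])

lift_definition times_sym_algebra :: "'a sym_algebra \<Rightarrow> 'a sym_algebra \<Rightarrow> 'a sym_algebra" is "(*)"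
  by (rule two_sided_ideal_mult_cong)

lift_definition scaleR_sym_algebra :: "real \<Rightarrow> 'a sym_algebra \<Rightarrow> 'a sym_algebra" is scaleR
  by (subst scaleR_diff_right [symmetric]) (rule subspace_scale [OF subspace_two_sided_ideal])

instance
proof
  have "1 \<notin> two_sided_ideal (sym_relations :: 'a free_algebra set)"
    by (rule one_notin_ideal) (rule eval_hom_sym_relations [OF linear_const_zero], simp_all)
  then have "(0 :: 'a free_algebra) - 1 \<notin> two_sided_ideal sym_relations"
    using subspace_neg [OF subspace_two_sided_ideal] by fastforce
  then show "(0 :: 'a sym_algebra) \<noteq> 1" by transfer
qed (transfer; simp add: algebra_simps subspace_0 [OF subspace_two_sided_ideal])+

end

lift_definition sym_gen :: "'v::real_vector \<Rightarrow> 'v sym_algebra" is "\<lambda>v. word [v]" .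

definition sym_power :: "nat \<Rightarrow> 'v::real_vector sym_algebra set"
  where "sym_power i = span {prod_list (map sym_gen vs) | vs. length vs = i}"

instantiation ext_algebra :: (real_vector) real_algebra_1
begin

lift_definition zero_ext_algebra :: "'a ext_algebra" is 0 .

lift_definition one_ext_algebra :: "'a ext_algebra" is 1 .

lift_definition plus_ext_algebra :: "'a ext_algebra \<Rightarrow> 'a ext_algebra \<Rightarrow> 'a ext_algebra" is "(+)"
  by (subst add_diff_add) (rule subspace_add [OF subspace_two_sided_ideal])

lift_definition uminus_ext_algebra :: "'a ext_algebra \<Rightarrow> 'a ext_algebra" is uminus
  by (subst minus_diff_minus) (rule subspace_neg [OF subspace_two_sided_ideal])

lift_definition minus_ext_algebra :: "'a ext_algebra \<Rightarrow> 'a ext_algebra \<Rightarrow> 'a ext_algebra" is "(-)"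
  by (subst diff_diff_swap) (rule subspace_diff [OF subspace_two_sided_ideal])

lift_definition times_ext_algebra :: "'a ext_algebra \<Rightarrow> 'a ext_algebra \<Rightarrow> 'a ext_algebra" is "(*)"
  by (rule two_sided_ideal_mult_cong)

lift_definition scaleR_ext_algebra :: "real \<Rightarrow> 'a ext_algebra \<Rightarrow> 'a ext_algebra" is scaleR
  by (subst scaleR_diff_right [symmetric]) (rule subspace_scale [OF subspace_two_sided_ideal])

instance
proof
  have "1 \<notin> two_sided_ideal (ext_relations :: 'a free_algebra set)"
    by (rule one_notin_ideal) (rule eval_hom_ext_relations [OF linear_const_zero], simp_all)
  then have "(0 :: 'a free_algebra) - 1 \<notin> two_sided_ideal ext_relations"
    using subspace_neg [OF subspace_two_sided_ideal] by fastforce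
  then show "(0 :: 'a ext_algebra) \<noteq> 1" by transfer
qed (transfer; simp add: algebra_simps subspace_0 [OF subspace_two_sided_ideal])+

end

lift_definition ext_gen :: "'v::real_vector \<Rightarrow> 'v ext_algebra" is "\<lambda>v. word [v]" .

definition ext_power :: "nat \<Rightarrow> 'v::real_vector ext_algebra set"
  where "ext_power i = span {prod_list (map ext_gen vs) | vs. length vs = i}"


instance sym_algebra :: (real_vector) comm_ring_1
proof
  fix x y :: "'a sym_algebra"
  have gen: "word [v] * word [w] - word [w] * word [v] \<in> two_sided_ideal sym_relations"
    for v w :: 'a
    by (rule two_sided_ideal_base) (auto simp: sym_relations_def)
  have gen_comm: "abs_sym_algebra (word [v]) * abs_sym_algebra (word [w])
      = abs_sym_algebra (word [w]) * abs_sym_algebra (word [v])" for v w :: 'a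
    by (simp add: times_sym_algebra.abs_eq sym_algebra.abs_eq_iff gen)
  have word_comm1: "abs_sym_algebra (word [v]) * abs_sym_algebra (word vs)
      = abs_sym_algebra (word vs) * abs_sym_algebra (word [v])" for v :: 'a and vs
  proof (induction vs)
    case Nil
    show ?case by (simp add: word_Nil flip: one_sym_algebra.abs_eq)
  next
    case (Cons w vs)
    have "abs_sym_algebra (word (w # vs)) = abs_sym_algebra (word [w]) * abs_sym_algebra (word vs)"
      by (subst word_Cons) (simp add: times_sym_algebra.abs_eq)
    then show ?case using Cons gen_comm by (metis mult.assoc)
  qed
  have word_comm: "abs_sym_algebra (word us) * abs_sym_algebra (word vs)
      = abs_sym_algebra (word vs) * abs_sym_algebra (word us)" for us vs :: "'a list"
  proof (induction us)
    case Nil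
    show ?case by (simp add: word_Nil flip: one_sym_algebra.abs_eq)
  next
    case (Cons w us)
    have "abs_sym_algebra (word (w # us)) = abs_sym_algebra (word [w]) * abs_sym_algebra (word us)"
      by (subst word_Cons) (simp add: times_sym_algebra.abs_eq)
    then show ?case using Cons word_comm1 by (metis mult.assoc)
  qed
  have comm1: "abs_sym_algebra (word us) * abs_sym_algebra q
      = abs_sym_algebra q * abs_sym_algebra (word us)" for us :: "'a list" and q
    by (induction q rule: free_algebra_induct)
      (simp_all add: word_comm distrib_left distrib_right
        flip: plus_sym_algebra.abs_eq scaleR_sym_algebra.abs_eq)
  have comm: "abs_sym_algebra p * abs_sym_algebra q = abs_sym_algebra q * abs_sym_algebra p"
    for p q :: "'a free_algebra"
    by (induction p rule: free_algebra_induct)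
      (simp_all add: comm1 distrib_left distrib_right
        flip: plus_sym_algebra.abs_eq scaleR_sym_algebra.abs_eq)
  show "x * y = y * x"
    by (induction x; induction y) (rule comm)
qed (simp_all add: distrib_right)


subsection \<open>Universal properties and induced maps\<close>

definition sym_map :: "('v::real_vector \<Rightarrow> 'w::real_vector) \<Rightarrow> 'v sym_algebra \<Rightarrow> 'w sym_algebra"
  where "sym_map f = (THE h. algebra_hom h \<and> (\<forall>v. h (sym_gen v) = sym_gen (f v)))"

definition ext_map :: "('v::real_vector \<Rightarrow> 'w::real_vector) \<Rightarrow> 'v ext_algebra \<Rightarrow> 'w ext_algebra"
  where "ext_map f = (THE h. algebra_hom h \<and> (\<forall>v. h (ext_gen v) = ext_gen (f v)))"

lemma linear_factor:
  assumes "linear A" "surj A" "linear F" "\<And>p. A p = 0 \<Longrightarrow> F p = 0"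
  shows "\<exists>h. linear h \<and> (\<forall>p. h (A p) = F p)"
proof -
  have eq: "F (inv_into UNIV A (A p)) = F p" for p
  proof -
    have "A (inv_into UNIV A (A p) - p) = 0"
      by (simp add: linear_diff [OF assms(1)] surj_f_inv_f [OF assms(2)])
    from assms(4) [OF this] show ?thesis by (simp add: linear_diff [OF assms(3)])
  qed
  have "linear (\<lambda>z. F (inv_into UNIV A z))"
  proof (rule linearI)
    fix z w
    obtain p q where "z = A p" "w = A q" using assms(2) by (metis surjD)
    then show "F (inv_into UNIV A (z + w)) = F (inv_into UNIV A z) + F (inv_into UNIV A w)"
      by (simp add: eq linear_add [OF assms(3)] flip: linear_add [OF assms(1)])
  next
    fix c z
    obtain p where "z = A p" using assms(2) by (metis surjD)
    then show "F (inv_into UNIV A (c *\<^sub>R z)) = c *\<^sub>R F (inv_into UNIV A z)"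
      by (simp add: eq linear_cmul [OF assms(3)] flip: linear_cmul [OF assms(1)])
  qed
  then show ?thesis using eq by blast
qed

lemma algebra_hom_prod_list:
  assumes "algebra_hom h"
  shows "h (prod_list xs) = prod_list (map h xs)"
  using assms by (induction xs) (simp_all add: algebra_hom_def)

lemma linear_abs_sym: "linear abs_sym_algebra"
  by (rule linearI) (simp_all add: plus_sym_algebra.abs_eq scaleR_sym_algebra.abs_eq)

lemma surj_abs_sym: "surj abs_sym_algebra"
  by (rule surjI [of _ rep_sym_algebra]) (rule Quotient_abs_rep [OF Quotient_sym_algebra])

lemma abs_sym_eq_0: "abs_sym_algebra p = 0 \<longleftrightarrow> p \<in> two_sided_ideal sym_relations"
  by (simp add: zero_sym_algebra.abs_eq sym_algebra.abs_eq_iff)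

lemma abs_sym_word: "abs_sym_algebra (word vs) = prod_list (map sym_gen vs)"
proof (induction vs)
  case Nil
  show ?case by (simp add: word_Nil one_sym_algebra.abs_eq)
next
  case (Cons v vs)
  have "abs_sym_algebra (word (v # vs)) = abs_sym_algebra (word [v]) * abs_sym_algebra (word vs)"
    by (subst word_Cons) (simp only: times_sym_algebra.abs_eq)
  then show ?case by (simp only: Cons.IH sym_gen.abs_eq [symmetric] list.map prod_list.Cons)
qed

lemma sym_algebra_induct [case_names word add scale]:
  assumes "\<And>vs. P (prod_list (map sym_gen vs))" "\<And>x y. P x \<Longrightarrow> P y \<Longrightarrow> P (x + y)"
    "\<And>c x. P x \<Longrightarrow> P (c *\<^sub>R x)"
  shows "P x"
proof -
  obtain p where p: "x = abs_sym_algebra p" using surj_abs_sym by (metis surjD)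
  have "P (abs_sym_algebra p)"
    by (induction p rule: free_algebra_induct)
      (simp_all add: abs_sym_word assms flip: plus_sym_algebra.abs_eq scaleR_sym_algebra.abs_eq)
  then show ?thesis by (simp only: p)
qed

lemma linear_sym_gen: "linear sym_gen"
proof (rule linearI)
  fix v w :: 'a and c :: real
  have "word [v + w] - word [v] - word [w] \<in> two_sided_ideal sym_relations"
    by (rule two_sided_ideal_base) (auto simp: sym_relations_def linear_relations_def)
  then show "sym_gen (v + w) = sym_gen v + sym_gen w"
    by (simp add: sym_gen.abs_eq plus_sym_algebra.abs_eq sym_algebra.abs_eq_iff diff_diff_add)
  have "word [c *\<^sub>R v] - c *\<^sub>R word [v] \<in> two_sided_ideal sym_relations"
    by (rule two_sided_ideal_base) (auto simp: sym_relations_def linear_relations_def)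
  then show "sym_gen (c *\<^sub>R v) = c *\<^sub>R sym_gen v"
    by (simp add: sym_gen.abs_eq scaleR_sym_algebra.abs_eq sym_algebra.abs_eq_iff)
qed

theorem sym_universal:
  fixes f :: "'v::real_vector \<Rightarrow> 'a::real_algebra_1"
  assumes "linear f" "\<And>v w. f v * f w = f w * f v"
  shows "\<exists>!h. algebra_hom h \<and> (\<forall>v. h (sym_gen v) = f v)"
proof (rule ex_ex1I)
  have "\<exists>h. linear h \<and> (\<forall>p. h (abs_sym_algebra p) = eval_hom f p)"
    by (rule linear_factor [OF linear_abs_sym surj_abs_sym linear_eval_hom])
      (use eval_hom_ideal [OF eval_hom_sym_relations [OF assms]] in \<open>simp add: abs_sym_eq_0\<close>)
  then obtain h where lin: "linear h" and h: "\<And>p. h (abs_sym_algebra p) = eval_hom f p"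
    by blast
  have "h (x * y) = h x * h y" for x y
  proof -
    obtain p q where "x = abs_sym_algebra p" "y = abs_sym_algebra q"
      using surj_abs_sym by (metis surjD)
    then show ?thesis by (simp add: times_sym_algebra.abs_eq h eval_hom_mult)
  qed
  moreover have "h 1 = 1"
    unfolding one_sym_algebra.abs_eq h word_Nil [symmetric] eval_hom_word by simp
  moreover have "h (sym_gen v) = f v" for v
    by (simp add: sym_gen.abs_eq h eval_hom_word)
  ultimately show "\<exists>h. algebra_hom h \<and> (\<forall>v. h (sym_gen v) = f v)"
    using lin unfolding algebra_hom_def by blast
next
  fix h h'
  assume h: "algebra_hom h \<and> (\<forall>v. h (sym_gen v) = f v)"
    and h': "algebra_hom h' \<and> (\<forall>v. h' (sym_gen v) = f v)"
  then have lin: "linear h" "linear h'" by (simp_all add: algebra_hom_def)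
  show "h = h'"
  proof (rule ext)
    fix x
    show "h x = h' x"
    proof (induction x rule: sym_algebra_induct)
      case (word vs)
      show ?case
        using h h' by (simp add: algebra_hom_prod_list comp_def)
    qed (simp_all add: linear_add [OF lin(1)] linear_add [OF lin(2)]
        linear_cmul [OF lin(1)] linear_cmul [OF lin(2)])
  qed
qed

theorem sym_map_ex1:
  assumes "linear f"
  shows "\<exists>!h. algebra_hom h \<and> (\<forall>v. h (sym_gen v) = sym_gen (f v))"
  by (rule sym_universal) (use linear_compose [OF assms linear_sym_gen] in \<open>simp_all add: comp_def mult.commute\<close>)

lemma
  assumes "linear f"
  shows algebra_hom_sym_map: "algebra_hom (sym_map f)"
    and sym_map_gen: "sym_map f (sym_gen v) = sym_gen (f v)"
proof -
  have "algebra_hom (sym_map f) \<and> (\<forall>v. sym_map f (sym_gen v) = sym_gen (f v))"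
    unfolding sym_map_def by (rule theI' [OF sym_map_ex1 [OF assms]])
  then show "algebra_hom (sym_map f)" "sym_map f (sym_gen v) = sym_gen (f v)"
    by simp_all
qed

lemma linear_abs_ext: "linear abs_ext_algebra"
  by (rule linearI) (simp_all add: plus_ext_algebra.abs_eq scaleR_ext_algebra.abs_eq)

lemma surj_abs_ext: "surj abs_ext_algebra"
  by (rule surjI [of _ rep_ext_algebra]) (rule Quotient_abs_rep [OF Quotient_ext_algebra])

lemma abs_ext_eq_0: "abs_ext_algebra p = 0 \<longleftrightarrow> p \<in> two_sided_ideal ext_relations"
  by (simp add: zero_ext_algebra.abs_eq ext_algebra.abs_eq_iff)

lemma abs_ext_word: "abs_ext_algebra (word vs) = prod_list (map ext_gen vs)"
proof (induction vs)
  case Nil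
  show ?case by (simp add: word_Nil one_ext_algebra.abs_eq)
next
  case (Cons v vs)
  have "abs_ext_algebra (word (v # vs)) = abs_ext_algebra (word [v]) * abs_ext_algebra (word vs)"
    by (subst word_Cons) (simp only: times_ext_algebra.abs_eq)
  then show ?case by (simp only: Cons.IH ext_gen.abs_eq [symmetric] list.map prod_list.Cons)
qed

lemma ext_algebra_induct [case_names word add scale]:
  assumes "\<And>vs. P (prod_list (map ext_gen vs))" "\<And>x y. P x \<Longrightarrow> P y \<Longrightarrow> P (x + y)"
    "\<And>c x. P x \<Longrightarrow> P (c *\<^sub>R x)"
  shows "P x"
proof -
  obtain p where p: "x = abs_ext_algebra p" using surj_abs_ext by (metis surjD)
  have "P (abs_ext_algebra p)"
    by (induction p rule: free_algebra_induct)
      (simp_all add: abs_ext_word assms flip: plus_ext_algebra.abs_eq scaleR_ext_algebra.abs_eq)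
  then show ?thesis by (simp only: p)
qed

lemma linear_ext_gen: "linear ext_gen"
proof (rule linearI)
  fix v w :: 'a and c :: real
  have "word [v + w] - word [v] - word [w] \<in> two_sided_ideal ext_relations"
    by (rule two_sided_ideal_base) (auto simp: ext_relations_def linear_relations_def)
  then show "ext_gen (v + w) = ext_gen v + ext_gen w"
    by (simp add: ext_gen.abs_eq plus_ext_algebra.abs_eq ext_algebra.abs_eq_iff diff_diff_add)
  have "word [c *\<^sub>R v] - c *\<^sub>R word [v] \<in> two_sided_ideal ext_relations"
    by (rule two_sided_ideal_base) (auto simp: ext_relations_def linear_relations_def)
  then show "ext_gen (c *\<^sub>R v) = c *\<^sub>R ext_gen v"
    by (simp add: ext_gen.abs_eq scaleR_ext_algebra.abs_eq ext_algebra.abs_eq_iff)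
qed

lemma ext_gen_square: "ext_gen v * ext_gen v = 0"
proof -
  have "word [v] * word [v] \<in> two_sided_ideal ext_relations"
    by (rule two_sided_ideal_base) (auto simp: ext_relations_def)
  then show ?thesis
    by (simp add: ext_gen.abs_eq times_ext_algebra.abs_eq abs_ext_eq_0)
qed

theorem ext_universal:
  fixes f :: "'v::real_vector \<Rightarrow> 'a::real_algebra_1"
  assumes "linear f" "\<And>v. f v * f v = 0"
  shows "\<exists>!h. algebra_hom h \<and> (\<forall>v. h (ext_gen v) = f v)"
proof (rule ex_ex1I)
  have "\<exists>h. linear h \<and> (\<forall>p. h (abs_ext_algebra p) = eval_hom f p)"
    by (rule linear_factor [OF linear_abs_ext surj_abs_ext linear_eval_hom])
      (use eval_hom_ideal [OF eval_hom_ext_relations [OF assms]] in \<open>simp add: abs_ext_eq_0\<close>)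
  then obtain h where lin: "linear h" and h: "\<And>p. h (abs_ext_algebra p) = eval_hom f p"
    by blast
  have "h (x * y) = h x * h y" for x y
  proof -
    obtain p q where "x = abs_ext_algebra p" "y = abs_ext_algebra q"
      using surj_abs_ext by (metis surjD)
    then show ?thesis by (simp add: times_ext_algebra.abs_eq h eval_hom_mult)
  qed
  moreover have "h 1 = 1"
    unfolding one_ext_algebra.abs_eq h word_Nil [symmetric] eval_hom_word by simp
  moreover have "h (ext_gen v) = f v" for v
    by (simp add: ext_gen.abs_eq h eval_hom_word)
  ultimately show "\<exists>h. algebra_hom h \<and> (\<forall>v. h (ext_gen v) = f v)"
    using lin unfolding algebra_hom_def by blast
next
  fix h h'
  assume h: "algebra_hom h \<and> (\<forall>v. h (ext_gen v) = f v)"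
    and h': "algebra_hom h' \<and> (\<forall>v. h' (ext_gen v) = f v)"
  then have lin: "linear h" "linear h'" by (simp_all add: algebra_hom_def)
  show "h = h'"
  proof (rule ext)
    fix x
    show "h x = h' x"
    proof (induction x rule: ext_algebra_induct)
      case (word vs)
      show ?case
        using h h' by (simp add: algebra_hom_prod_list comp_def)
    qed (simp_all add: linear_add [OF lin(1)] linear_add [OF lin(2)]
        linear_cmul [OF lin(1)] linear_cmul [OF lin(2)])
  qed
qed

theorem ext_map_ex1:
  assumes "linear f"
  shows "\<exists>!h. algebra_hom h \<and> (\<forall>v. h (ext_gen v) = ext_gen (f v))"
  by (rule ext_universal) (use linear_compose [OF assms linear_ext_gen] in \<open>simp_all add: comp_def ext_gen_square\<close>)

lemma
  assumes "linear f"
  shows algebra_hom_ext_map: "algebra_hom (ext_map f)"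
    and ext_map_gen: "ext_map f (ext_gen v) = ext_gen (f v)"
proof -
  have "algebra_hom (ext_map f) \<and> (\<forall>v. ext_map f (ext_gen v) = ext_gen (f v))"
    unfolding ext_map_def by (rule theI' [OF ext_map_ex1 [OF assms]])
  then show "algebra_hom (ext_map f)" "ext_map f (ext_gen v) = ext_gen (f v)"
    by simp_all
qed


subsection \<open>Partial derivatives and interior products\<close>

definition is_derivation :: "('v::real_vector \<Rightarrow> real) \<Rightarrow> ('v sym_algebra \<Rightarrow> 'v sym_algebra) \<Rightarrow> bool"
  where "is_derivation \<alpha> D \<longleftrightarrow> linear D \<and> (\<forall>v. D (sym_gen v) = of_real (\<alpha> v))
    \<and> (\<forall>x y. D (x * y) = D x * y + x * D y)"

text \<open>
  Under the identification of \<open>Sym(V)\<close> with the polynomial ring in the elements of a basis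
  \<open>t\<close> of \<open>V\<close>, the partial derivative in the direction \<open>t k\<close> is the derivation that sends
  \<open>t k\<close> to \<open>1\<close> and the other \<open>t j\<close> to \<open>0\<close>, that is, \<open>sym_deriv \<alpha>\<close> for the element \<open>\<alpha>\<close> of the dual
  basis at \<open>k\<close>.
\<close>

definition sym_deriv :: "('v::real_vector \<Rightarrow> real) \<Rightarrow> 'v sym_algebra \<Rightarrow> 'v sym_algebra"
  where "sym_deriv \<alpha> = (THE D. is_derivation \<alpha> D)"

definition is_interior_product ::
  "('v::real_vector \<Rightarrow> real) \<Rightarrow> ('v ext_algebra \<Rightarrow> 'v ext_algebra) \<Rightarrow> bool"
  where "is_interior_product \<alpha> D \<longleftrightarrow> linear D
    \<and> (\<forall>p. D ` ext_power (Suc p) \<subseteq> ext_power p)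
    \<and> (\<forall>c. D (of_real c) = 0)
    \<and> (\<forall>v. D (ext_gen v) = of_real (\<alpha> v))
    \<and> (\<forall>p u w. u \<in> ext_power p \<longrightarrow> D (u * w) = D u * w + (-1) ^ p * (u * D w))"

definition interior_product :: "('v::real_vector \<Rightarrow> real) \<Rightarrow> 'v ext_algebra \<Rightarrow> 'v ext_algebra"
  where "interior_product \<alpha> = (THE D. is_interior_product \<alpha> D)"

fun contract :: "real \<Rightarrow> ('v \<Rightarrow> real) \<Rightarrow> ('v \<Rightarrow> 'a::real_algebra_1) \<Rightarrow> 'v list \<Rightarrow> 'a" where
  "contract \<epsilon> \<alpha> f [] = 0"
| "contract \<epsilon> \<alpha> f (v # vs) = \<alpha> v *\<^sub>R prod_list (map f vs) + \<epsilon> *\<^sub>R (f v * contract \<epsilon> \<alpha> f vs)"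

lemma contract_append:
  "contract \<epsilon> \<alpha> f (us @ vs) = contract \<epsilon> \<alpha> f us * prod_list (map f vs)
    + \<epsilon> ^ length us *\<^sub>R (prod_list (map f us) * contract \<epsilon> \<alpha> f vs)"
  by (induction us) (simp_all add: algebra_simps)

text \<open>
  For \<open>\<epsilon> = 1\<close> this is the derivation on the symmetric algebra, for \<open>\<epsilon> = -1\<close> the anti-derivation on
  the exterior algebra, evaluated on a product of vectors; it serves only to prove existence.
\<close>

definition contract_ext ::
  "real \<Rightarrow> ('v \<Rightarrow> real) \<Rightarrow> ('v \<Rightarrow> 'a::real_algebra_1) \<Rightarrow> 'v free_algebra \<Rightarrow> 'a"
  where "contract_ext \<epsilon> \<alpha> f = lin_ext (\<lambda>w. contract \<epsilon> \<alpha> f (letters w))"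

lemma linear_contract_ext: "linear (contract_ext \<epsilon> \<alpha> f)"
  unfolding contract_ext_def by (rule linear_lin_ext)

lemma contract_ext_word: "contract_ext \<epsilon> \<alpha> f (word vs) = contract \<epsilon> \<alpha> f vs"
  by (simp add: contract_ext_def word_def)

lemma contract_ext_linear_relations:
  assumes \<alpha>: "linear \<alpha>" and f: "linear f" and s: "s \<in> linear_relations"
  shows "contract_ext \<epsilon> \<alpha> f (word us * s * word vs) = 0"
proof -
  note lin = linear_diff [OF linear_contract_ext] linear_cmul [OF linear_contract_ext]
  from s consider v w where "s = word [v + w] - word [v] - word [w]"
    | c v where "s = word [c *\<^sub>R v] - c *\<^sub>R word [v]"
    unfolding linear_relations_def by blast
  then show ?thesis
  proof cases
    case 1
    have eq: "word us * s * word vs = word (us @ [v + w] @ vs) - word (us @ [v] @ vs) - word (us @ [w] @ vs)"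
      unfolding 1 word_append by (simp add: algebra_simps)
    show ?thesis
      unfolding eq lin contract_ext_word
      by (simp add: contract_append linear_add [OF \<alpha>] linear_add [OF f] algebra_simps)
  next
    case 2
    have eq: "word us * s * word vs = word (us @ [c *\<^sub>R v] @ vs) - c *\<^sub>R word (us @ [v] @ vs)"
      unfolding 2 word_append by (simp add: algebra_simps)
    show ?thesis
      unfolding eq lin contract_ext_word
      by (simp add: contract_append linear_cmul [OF \<alpha>] linear_cmul [OF f] algebra_simps)
  qed
qed

lemma contract_ext_sym_relations:
  assumes \<alpha>: "linear \<alpha>" and s: "s \<in> sym_relations"
  shows "contract_ext 1 \<alpha> sym_gen (word us * s * word vs) = 0"
proof -
  from s consider "s \<in> linear_relations"
    | v w where "s = word [v] * word [w] - word [w] * word [v]"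
    unfolding sym_relations_def by blast
  then show ?thesis
  proof cases
    case 2
    have eq: "word us * s * word vs = word (us @ [v, w] @ vs) - word (us @ [w, v] @ vs)"
      unfolding 2 word_append word_Cons [of v "[w]"] word_Cons [of w "[v]"] by (simp add: algebra_simps)
    show ?thesis
      unfolding eq linear_diff [OF linear_contract_ext] contract_ext_word
      by (simp add: contract_append algebra_simps)
  qed (rule contract_ext_linear_relations [OF \<alpha> linear_sym_gen])
qed

lemma ext_gen_square_left: "ext_gen v * (ext_gen v * x) = 0"
  by (simp add: ext_gen_square flip: mult.assoc)

lemma contract_ext_ext_relations:
  assumes \<alpha>: "linear \<alpha>" and s: "s \<in> ext_relations"
  shows "contract_ext (-1) \<alpha> ext_gen (word us * s * word vs) = 0"
proof -
  from s consider "s \<in> linear_relations" | v where "s = word [v] * word [v]"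
    unfolding ext_relations_def by blast
  then show ?thesis
  proof cases
    case 2
    have eq: "word us * s * word vs = word (us @ [v, v] @ vs)"
      unfolding 2 word_append word_Cons [of v "[v]"] by (simp add: mult.assoc)
    show ?thesis
      unfolding eq contract_ext_word
      by (simp add: contract_append algebra_simps ext_gen_square ext_gen_square_left)
  qed (rule contract_ext_linear_relations [OF \<alpha> linear_ext_gen])
qed

theorem sym_deriv_ex1:
  fixes \<alpha> :: "'v::real_vector \<Rightarrow> real"
  assumes "linear \<alpha>"
  shows "\<exists>!D. is_derivation \<alpha> D"
proof (rule ex_ex1I)
  have "\<exists>h. linear h \<and> (\<forall>p. h (abs_sym_algebra p) = contract_ext 1 \<alpha> sym_gen p)"
  proof (rule linear_factor [OF linear_abs_sym surj_abs_sym linear_contract_ext])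
    fix p assume "abs_sym_algebra p = (0 :: 'v sym_algebra)"
    then have "p \<in> two_sided_ideal sym_relations" by (simp only: abs_sym_eq_0)
    then show "contract_ext 1 \<alpha> sym_gen p = 0"
      by (rule linear_zero_on_ideal [OF linear_contract_ext, rotated])
        (rule contract_ext_sym_relations [OF assms])
  qed
  then obtain D where lin: "linear D"
    and D: "\<And>p. D (abs_sym_algebra p) = contract_ext 1 \<alpha> sym_gen p"
    by blast
  have D_prod: "D (prod_list (map sym_gen vs)) = contract 1 \<alpha> sym_gen vs" for vs
    by (simp add: D contract_ext_word flip: abs_sym_word)
  have "D (sym_gen v) = of_real (\<alpha> v)" for v
    using D_prod [of "[v]"] by (simp add: of_real_def)
  moreover have "D (x * y) = D x * y + x * D y" for x y
  proof (induction x rule: sym_algebra_induct)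
    case (word us)
    show ?case
    proof (induction y rule: sym_algebra_induct)
      case (word vs)
      show ?case
        using D_prod [of "us @ vs"] by (simp add: D_prod contract_append)
    qed (simp_all add: linear_add [OF lin] linear_cmul [OF lin] algebra_simps)
  qed (simp_all add: linear_add [OF lin] linear_cmul [OF lin] algebra_simps)
  ultimately show "\<exists>D. is_derivation \<alpha> D"
    using lin unfolding is_derivation_def by blast
next
  fix D D' assume "is_derivation \<alpha> D" "is_derivation \<alpha> D'"
  then have lin: "linear D" "linear D'"
    and gen: "\<And>v. D (sym_gen v) = of_real (\<alpha> v)" "\<And>v. D' (sym_gen v) = of_real (\<alpha> v)"
    and mult: "\<And>x y. D (x * y) = D x * y + x * D y" "\<And>x y. D' (x * y) = D' x * y + x * D' y"
    by (simp_all add: is_derivation_def)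
  have one: "D 1 = 0" "D' 1 = 0"
    using mult(1) [of 1 1] mult(2) [of 1 1] by simp_all
  show "D = D'"
  proof (rule ext)
    fix x
    show "D x = D' x"
    proof (induction x rule: sym_algebra_induct)
      case (word vs)
      show ?case by (induction vs) (simp_all add: one mult gen)
    qed (simp_all add: linear_add [OF lin(1)] linear_add [OF lin(2)]
        linear_cmul [OF lin(1)] linear_cmul [OF lin(2)])
  qed
qed

theorem interior_product_ex1:
  fixes \<alpha> :: "'v::real_vector \<Rightarrow> real"
  assumes "linear \<alpha>"
  shows "\<exists>!D. is_interior_product \<alpha> D"
proof (rule ex_ex1I)
  have "\<exists>h. linear h \<and> (\<forall>p. h (abs_ext_algebra p) = contract_ext (-1) \<alpha> ext_gen p)"
  proof (rule linear_factor [OF linear_abs_ext surj_abs_ext linear_contract_ext])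
    fix p assume "abs_ext_algebra p = (0 :: 'v ext_algebra)"
    then have "p \<in> two_sided_ideal ext_relations" by (simp only: abs_ext_eq_0)
    then show "contract_ext (-1) \<alpha> ext_gen p = 0"
      by (rule linear_zero_on_ideal [OF linear_contract_ext, rotated])
        (rule contract_ext_ext_relations [OF assms])
  qed
  then obtain D where lin: "linear D"
    and D: "\<And>p. D (abs_ext_algebra p) = contract_ext (-1) \<alpha> ext_gen p"
    by blast
  have D_prod: "D (prod_list (map ext_gen vs)) = contract (-1) \<alpha> ext_gen vs" for vs
    by (simp add: D contract_ext_word flip: abs_ext_word)
  have gen: "D (ext_gen v) = of_real (\<alpha> v)" for v
    using D_prod [of "[v]"] by (simp add: of_real_def)
  have scalar: "D (of_real c) = 0" for c
    using D_prod [of "[]"] by (simp add: of_real_def linear_cmul [OF lin])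
  have mem: "prod_list (map ext_gen vs) \<in> ext_power (length vs)" for vs :: "'v list"
    unfolding ext_power_def by (rule span_base) blast
  have step: "ext_gen v * x \<in> ext_power (Suc p)" if "x \<in> ext_power p" for v :: 'v and x p
    using that unfolding ext_power_def
  proof (induction rule: span_induct_alt)
    case base
    show ?case by (simp add: span_zero)
  next
    case (step c x y)
    then obtain vs where "x = prod_list (map ext_gen vs)" "length vs = p" by blast
    then have "ext_gen v * x = prod_list (map ext_gen (v # vs)) \<and> length (v # vs) = Suc p" by simp
    then have "ext_gen v * x \<in> span {prod_list (map ext_gen vs) | vs. length vs = Suc p}"
      by (intro span_base) blast
    then show ?case using step(2) by (simp add: distrib_left span_add span_scale)
  qed
  have contract_mem: "contract (-1) \<alpha> ext_gen (v # vs) \<in> ext_power (length vs)" for v vs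
  proof (induction vs arbitrary: v)
    case Nil
    show ?case using mem [of "[]"] by (simp add: ext_power_def span_scale)
  next
    case (Cons w vs)
    show ?case
      using mem [of "w # vs"] step [OF Cons.IH [of w], of v]
      unfolding contract.simps(2) [of _ _ _ v] ext_power_def
      by (intro span_add span_scale) simp_all
  qed
  have degree: "D x \<in> ext_power p" if "x \<in> ext_power (Suc p)" for x p
    using that unfolding ext_power_def [of "Suc p"]
  proof (induction rule: span_induct_alt)
    case base
    show ?case by (simp add: linear_0 [OF lin] ext_power_def span_zero)
  next
    case (step c x y)
    then obtain vs where "x = prod_list (map ext_gen vs)" "length vs = Suc p" by blast
    moreover then obtain v ws where "vs = v # ws" by (metis length_Suc_conv)
    ultimately have "D x \<in> ext_power p" using contract_mem [of v ws] by (simp only: D_prod) simp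
    then show ?case
      using step(2) by (simp add: linear_add [OF lin] linear_cmul [OF lin] ext_power_def span_add span_scale)
  qed
  have sign: "(- 1) ^ p *\<^sub>R z = (-1) ^ p * z" for p and z :: "'v ext_algebra"
    by (cases "even p") simp_all
  have mult: "D (u * w) = D u * w + (-1) ^ p * (u * D w)" if "u \<in> ext_power p" for p u w
    using that unfolding ext_power_def
  proof (induction rule: span_induct_alt)
    case base
    show ?case by (simp add: linear_0 [OF lin])
  next
    case (step c x y)
    then obtain us where x: "x = prod_list (map ext_gen us)" and len: "length us = p" by blast
    have "D (x * w) = D x * w + (-1) ^ p * (x * D w)"
    proof (induction w rule: ext_algebra_induct)
      case (word vs)
      show ?case
        using D_prod [of "us @ vs"] by (simp add: x len D_prod contract_append sign)
    qed (simp_all add: linear_add [OF lin] linear_cmul [OF lin] algebra_simps)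
    with step(2) show ?case
      by (simp add: linear_add [OF lin] linear_cmul [OF lin] algebra_simps)
  qed
  show "\<exists>D. is_interior_product \<alpha> D"
    unfolding is_interior_product_def using lin degree scalar gen mult by blast
next
  fix D D' assume "is_interior_product \<alpha> D" "is_interior_product \<alpha> D'"
  then have lin: "linear D" "linear D'"
    and scalar: "\<And>c. D (of_real c) = 0" "\<And>c. D' (of_real c) = 0"
    and gen: "\<And>v. D (ext_gen v) = of_real (\<alpha> v)" "\<And>v. D' (ext_gen v) = of_real (\<alpha> v)"
    and mult: "\<And>p u w. u \<in> ext_power p \<Longrightarrow> D (u * w) = D u * w + (-1) ^ p * (u * D w)"
      "\<And>p u w. u \<in> ext_power p \<Longrightarrow> D' (u * w) = D' u * w + (-1) ^ p * (u * D' w)"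
    unfolding is_interior_product_def by blast+
  have one: "D 1 = 0" "D' 1 = 0"
    using scalar(1) [of 1] scalar(2) [of 1] by simp_all
  have mem: "ext_gen v \<in> ext_power 1" for v :: 'v
    unfolding ext_power_def by (rule span_base, rule CollectI, rule exI [of _ "[v]"]) simp
  show "D = D'"
  proof (rule ext)
    fix x
    show "D x = D' x"
    proof (induction x rule: ext_algebra_induct)
      case (word vs)
      show ?case by (induction vs) (simp_all add: one mult [OF mem] gen)
    qed (simp_all add: linear_add [OF lin(1)] linear_add [OF lin(2)]
        linear_cmul [OF lin(1)] linear_cmul [OF lin(2)])
  qed
qed


section \<open>Representations\<close>

text \<open>
  A representation lives on a subspace \<open>U\<close> of an ambient real vector space; every group element
  acts by a linear map of the ambient space that preserves \<open>U\<close>, and only the restriction to \<open>U\<close>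
  has to respect the group structure. Likewise, linear maps between subspaces are taken to be
  restrictions of linear maps of the ambient spaces; every linear map on a subspace extends.
\<close>

definition group_representation ::
  "('g, 'm) monoid_scheme \<Rightarrow> 'a::real_vector set \<Rightarrow> ('g \<Rightarrow> 'a \<Rightarrow> 'a) \<Rightarrow> bool"
  where "group_representation G U \<rho> \<longleftrightarrow> group G \<and> subspace U
    \<and> (\<forall>g\<in>carrier G. linear (\<rho> g) \<and> \<rho> g ` U \<subseteq> U)
    \<and> (\<forall>u\<in>U. \<rho> \<one>\<^bsub>G\<^esub> u = u)
    \<and> (\<forall>g\<in>carrier G. \<forall>h\<in>carrier G. \<forall>u\<in>U. \<rho> (g \<otimes>\<^bsub>G\<^esub> h) u = \<rho> g (\<rho> h u))"

definition finite_dimensional :: "'a::real_vector set \<Rightarrow> bool"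
  where "finite_dimensional U \<longleftrightarrow> (\<exists>B. finite B \<and> span B = U)"

definition subrepresentation ::
  "('g, 'm) monoid_scheme \<Rightarrow> 'a::real_vector set \<Rightarrow> ('g \<Rightarrow> 'a \<Rightarrow> 'a) \<Rightarrow> 'a set \<Rightarrow> bool"
  where "subrepresentation G U \<rho> S \<longleftrightarrow> subspace S \<and> S \<subseteq> U \<and> (\<forall>g\<in>carrier G. \<rho> g ` S \<subseteq> S)"

definition equivariant ::
  "('g, 'm) monoid_scheme \<Rightarrow> 'a::real_vector set \<Rightarrow> ('g \<Rightarrow> 'a \<Rightarrow> 'a) \<Rightarrow> ('g \<Rightarrow> 'b::real_vector \<Rightarrow> 'b)
    \<Rightarrow> ('a \<Rightarrow> 'b) \<Rightarrow> bool"
  where "equivariant G U \<rho> \<sigma> \<phi> \<longleftrightarrow> (\<forall>g\<in>carrier G. \<forall>u\<in>U. \<phi> (\<rho> g u) = \<sigma> g (\<phi> u))"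

definition isomorphic_representations ::
  "('g, 'm) monoid_scheme \<Rightarrow> 'a::real_vector set \<Rightarrow> ('g \<Rightarrow> 'a \<Rightarrow> 'a)
    \<Rightarrow> 'b::real_vector set \<Rightarrow> ('g \<Rightarrow> 'b \<Rightarrow> 'b) \<Rightarrow> bool"
  where "isomorphic_representations G U \<rho> W \<sigma> \<longleftrightarrow>
    (\<exists>\<phi>. linear \<phi> \<and> bij_betw \<phi> U W \<and> equivariant G U \<rho> \<sigma> \<phi>)"

definition tensor_action ::
  "('g \<Rightarrow> 'a::real_vector \<Rightarrow> 'a) \<Rightarrow> ('g \<Rightarrow> 'b::real_vector \<Rightarrow> 'b) \<Rightarrow> 'g \<Rightarrow> ('a, 'b) tensor \<Rightarrow> ('a, 'b) tensor"
  where "tensor_action \<rho> \<sigma> g = tensor_map (\<rho> g) (\<sigma> g)"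

definition equivariantly_log_concave ::
  "('g, 'm) monoid_scheme \<Rightarrow> (nat \<Rightarrow> 'a::real_vector set) \<Rightarrow> (nat \<Rightarrow> 'g \<Rightarrow> 'a \<Rightarrow> 'a) \<Rightarrow> bool"
  where "equivariantly_log_concave G W \<rho> \<longleftrightarrow>
    (\<forall>i. group_representation G (W i) (\<rho> i) \<and> finite_dimensional (W i)) \<and>
    (\<forall>i\<ge>1. \<exists>S. subrepresentation G (tensor_subspace (W i) (W i)) (tensor_action (\<rho> i) (\<rho> i)) S
      \<and> isomorphic_representations G
          (tensor_subspace (W (i - 1)) (W (i + 1))) (tensor_action (\<rho> (i - 1)) (\<rho> (i + 1)))
          S (tensor_action (\<rho> i) (\<rho> i)))"


section \<open>Lefschetz operators\<close>

definition is_basis :: "nat \<Rightarrow> (nat \<Rightarrow> 'v::real_vector) \<Rightarrow> bool"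
  where "is_basis n t \<longleftrightarrow> inj_on t {1..n} \<and> independent (t ` {1..n}) \<and> span (t ` {1..n}) = UNIV"

definition dual_basis :: "nat \<Rightarrow> (nat \<Rightarrow> 'v::real_vector) \<Rightarrow> nat \<Rightarrow> 'v \<Rightarrow> real"
  where "dual_basis n t k v = representation (t ` {1..n}) v (t k)"

definition sym_lefschetz ::
  "nat \<Rightarrow> (nat \<Rightarrow> 'v::real_vector)
    \<Rightarrow> ('v sym_algebra, 'v sym_algebra) tensor \<Rightarrow> ('v sym_algebra, 'v sym_algebra) tensor"
  where "sym_lefschetz n t x =
    (\<Sum>k=1..n. tensor_map (\<lambda>u. sym_gen (t k) * u) (sym_deriv (dual_basis n t k)) x)"

text \<open>Following the source, no Koszul sign enters the tensor product of the two odd operators.\<close>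

definition ext_lefschetz ::
  "nat \<Rightarrow> (nat \<Rightarrow> 'v::real_vector)
    \<Rightarrow> ('v ext_algebra, 'v ext_algebra) tensor \<Rightarrow> ('v ext_algebra, 'v ext_algebra) tensor"
  where "ext_lefschetz n t x =
    (\<Sum>k=1..n. tensor_map (\<lambda>u. ext_gen (t k) * u) (interior_product (dual_basis n t k)) x)"

lemma
  assumes "is_basis n t"
  shows linear_dual_basis: "linear (dual_basis n t k)"
    and dual_basis_apply: "j \<in> {1..n} \<Longrightarrow> k \<in> {1..n} \<Longrightarrow> dual_basis n t k (t j) = (if j = k then 1 else 0)"
proof -
  have ind: "independent (t ` {1..n})" and sp: "v \<in> span (t ` {1..n})" and inj: "inj_on t {1..n}" for v
    using assms by (simp_all add: is_basis_def)
  show "linear (dual_basis n t k)"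
    by (rule linearI)
      (simp_all add: dual_basis_def representation_add [OF ind sp sp] representation_scale [OF ind sp]
        del: One_nat_def)
  show "dual_basis n t k (t j) = (if j = k then 1 else 0)" if "j \<in> {1..n}" "k \<in> {1..n}"
    unfolding dual_basis_def
    using that inj by (simp add: representation_basis [OF ind] inj_on_eq_iff del: One_nat_def)
qed

end

theory Submission
  imports Defs
begin

text \<open>
  Injectivity is a lowest-weight argument for \<open>sl\<^sub>2\<close>. Next to \<open>L = \<Sum>\<^sub>k t\<^sub>k \<otimes> \<partial>\<^sub>k\<close> consider
  the mirrored operator \<open>M = \<Sum>\<^sub>k \<partial>\<^sub>k \<otimes> t\<^sub>k\<close>, where in the exterior case \<open>t\<^sub>k\<close> is the wedge product
  and \<open>\<partial>\<^sub>k\<close> the interior product. In both cases \<open>\<partial>\<^sub>k t\<^sub>l = \<delta>\<^sub>k\<^sub>l + \<epsilon> t\<^sub>l \<partial>\<^sub>k\<close> with \<open>\<epsilon> = 1\<close>, respectively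
  \<open>\<epsilon> = -1\<close>. Expanding \<open>LM\<close> and \<open>ML\<close> with this relation, the terms that carry \<open>\<epsilon>\<close> are the same
  and cancel. What remains is
  \<open>E \<otimes> 1 - 1 \<otimes> E\<close> for the Euler operator \<open>E = \<Sum>\<^sub>k t\<^sub>k \<partial>\<^sub>k\<close>, which multiplies elements of degree \<open>i\<close>
  by \<open>i\<close>. Hence \<open>LM - ML\<close> is the scalar \<open>a - b\<close> in bidegree \<open>(a, b)\<close>
  (\<open>lefschetz_commutator\<close>). Since \<open>M\<close> lowers the first degree, iterating it on an element of bidegree
  \<open>(a, b)\<close> ends in zero, and climbing back up with the commutator, all of whose scalars are negative
  when \<open>a < b\<close>, shows that \<open>ML\<close> has no eigenvalue \<open>\<le> 0\<close> there
  (\<open>no_nonpositive_eigenvalue\<close>); in particular \<open>L\<close> is injective.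

  Equivariance holds because \<open>\<Sum>\<^sub>k t\<^sub>k \<otimes> t\<^sub>k\<^sup>*\<close> is the canonical element of \<open>V \<otimes> V\<^sup>*\<close>, so \<open>L\<close> commutes
  with the maps induced by every linear endomorphism of \<open>V\<close> (\<open>lefschetz_natural\<close>). The image of
  \<open>L\<close> is then the subrepresentation that log-concavity asks for.

  The argument uses only a graded algebra generated by \<open>V\<close> with contractions obeying the relation
  above, so it is carried out once in the locale \<open>contraction_algebra\<close>, of which the symmetric and the
  exterior algebra are instances.
\<close>

section \<open>Linear maps on tensor products of subspaces\<close>

lemma tensor_in_tensor_subspace: "x \<in> U \<Longrightarrow> y \<in> W \<Longrightarrow> x \<otimes>\<^sub>\<real> y \<in> tensor_subspace U W"
  unfolding tensor_subspace_def by (rule span_base) blast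

lemma subspace_tensor_subspace: "subspace (tensor_subspace U W)"
  unfolding tensor_subspace_def by (rule subspace_span)

lemma tensor_subspace_UNIV: "tensor_subspace UNIV UNIV = UNIV"
  unfolding tensor_subspace_def using span_tensors by simp

lemma linear_eq_on_tensor_subspace:
  assumes "linear h" "linear h'"
    and "\<And>x y. x \<in> U \<Longrightarrow> y \<in> W \<Longrightarrow> h (x \<otimes>\<^sub>\<real> y) = h' (x \<otimes>\<^sub>\<real> y)"
    and "z \<in> tensor_subspace U W"
  shows "h z = h' z"
  using assms(4) unfolding tensor_subspace_def
  by (rule linear_eq_on_span [OF assms(1,2), rotated]) (use assms(3) in blast)

lemma linear_image_tensor_subspace:
  assumes "linear h" "subspace S"
    and "\<And>x y. x \<in> U \<Longrightarrow> y \<in> W \<Longrightarrow> h (x \<otimes>\<^sub>\<real> y) \<in> S"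
  shows "h ` tensor_subspace U W \<subseteq> S"
  unfolding tensor_subspace_def linear_span_image [OF assms(1), symmetric]
  by (rule span_minimal) (use assms(2,3) in auto)

lemma tensor_zero_left: "0 \<otimes>\<^sub>\<real> y = 0"
  using tensor_scaleR_left [of 0 0 y] by simp

lemma tensor_zero_right: "x \<otimes>\<^sub>\<real> 0 = 0"
  using tensor_scaleR_right [of x 0 0] by simp

lemma tensor_sum_left: "(\<Sum>k\<in>K. f k) \<otimes>\<^sub>\<real> y = (\<Sum>k\<in>K. f k \<otimes>\<^sub>\<real> y)"
  by (rule linear_sum) (rule linearI, simp_all add: tensor_add_left tensor_scaleR_left)

lemma tensor_sum_right: "x \<otimes>\<^sub>\<real> (\<Sum>k\<in>K. f k) = (\<Sum>k\<in>K. x \<otimes>\<^sub>\<real> f k)"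
  by (rule linear_sum) (rule linearI, simp_all add: tensor_add_right tensor_scaleR_right)

lemma linear_mult_left: "linear (\<lambda>u. (a :: 'a::real_algebra_1) * u)"
  by (rule linearI) (simp_all add: distrib_left)

section \<open>Expansion in a basis\<close>

lemma basis_expansion:
  assumes "is_basis n t"
  shows "(\<Sum>k=1..n. dual_basis n t k v *\<^sub>R t k) = v"
proof -
  have ind: "independent (t ` {1..n})" and sp: "span (t ` {1..n}) = UNIV" and inj: "inj_on t {1..n}"
    using assms by (simp_all add: is_basis_def)
  have "(\<Sum>b\<in>t ` {1..n}. representation (t ` {1..n}) v b *\<^sub>R b) = v"
    by (rule sum_representation_eq [OF ind]) (simp_all add: sp del: One_nat_def)
  then show ?thesis
    by (simp add: sum.reindex [OF inj] dual_basis_def del: One_nat_def)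
qed

lemma dual_basis_compose:
  assumes "is_basis n t" "linear f"
  shows "dual_basis n t k (f v) = (\<Sum>j=1..n. dual_basis n t k (f (t j)) * dual_basis n t j v)"
proof -
  have lin: "linear (\<lambda>v. dual_basis n t k (f v))"
    using linear_compose [OF assms(2) linear_dual_basis [OF assms(1)]] by (simp add: comp_def)
  have "dual_basis n t k (f v) = dual_basis n t k (f (\<Sum>j=1..n. dual_basis n t j v *\<^sub>R t j))"
    by (simp only: basis_expansion [OF assms(1)])
  also have "\<dots> = (\<Sum>j=1..n. dual_basis n t j v *\<^sub>R dual_basis n t k (f (t j)))"
    by (simp only: linear_sum [OF lin] linear_cmul [OF lin])
  finally show ?thesis by (simp add: mult.commute)
qed

section \<open>Algebras with contractions\<close>

text \<open>
  The common features of \<open>Sym(V)\<close> and \<open>\<Lambda>(V)\<close>: the value of a contraction on a product of vectors is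
  determined by the recursion \<open>contraction_gen_mult\<close>, which is the Leibniz rule for \<open>\<epsilon> = 1\<close> and its
  graded version for \<open>\<epsilon> = -1\<close>.
\<close>

locale contraction_algebra =
  fixes \<epsilon> :: real
    and gen :: "'v::real_vector \<Rightarrow> 'a::real_algebra_1"
    and contraction :: "('v \<Rightarrow> real) \<Rightarrow> 'a \<Rightarrow> 'a"
    and induced :: "('v \<Rightarrow> 'v) \<Rightarrow> 'a \<Rightarrow> 'a"
  assumes sign_square: "\<epsilon> * \<epsilon> = 1"
    and linear_gen: "linear gen"
    and gen_commute: "gen v * gen w = \<epsilon> *\<^sub>R (gen w * gen v)"
    and generated: "span (range (\<lambda>vs. prod_list (map gen vs))) = UNIV"
    and linear_contraction: "linear \<alpha> \<Longrightarrow> linear (contraction \<alpha>)"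
    and contraction_one: "linear \<alpha> \<Longrightarrow> contraction \<alpha> 1 = 0"
    and contraction_gen_mult: "linear \<alpha> \<Longrightarrow>
      contraction \<alpha> (gen v * x) = \<alpha> v *\<^sub>R x + \<epsilon> *\<^sub>R (gen v * contraction \<alpha> x)"
    and algebra_hom_induced: "linear f \<Longrightarrow> algebra_hom (induced f)"
    and induced_gen: "linear f \<Longrightarrow> induced f (gen v) = gen (f v)"
begin

definition homogeneous :: "nat \<Rightarrow> 'a set"
  where "homogeneous i = span {prod_list (map gen vs) | vs. length vs = i}"

definition lefschetz :: "nat \<Rightarrow> (nat \<Rightarrow> 'v) \<Rightarrow> ('a, 'a) tensor \<Rightarrow> ('a, 'a) tensor"
  where "lefschetz n t z =
    (\<Sum>k=1..n. tensor_map (\<lambda>u. gen (t k) * u) (contraction (dual_basis n t k)) z)"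

text \<open>The mirror image of \<open>lefschetz\<close>, its partner in the \<open>sl\<^sub>2\<close>-triple.\<close>

definition dual_lefschetz :: "nat \<Rightarrow> (nat \<Rightarrow> 'v) \<Rightarrow> ('a, 'a) tensor \<Rightarrow> ('a, 'a) tensor"
  where "dual_lefschetz n t z =
    (\<Sum>k=1..n. tensor_map (contraction (dual_basis n t k)) (\<lambda>u. gen (t k) * u) z)"

subsection \<open>The grading\<close>

lemma generated_induct [case_names one gen add scale]:
  assumes "P 1" "\<And>v x. P x \<Longrightarrow> P (gen v * x)"
    and "\<And>x y. P x \<Longrightarrow> P y \<Longrightarrow> P (x + y)" "\<And>c x. P x \<Longrightarrow> P (c *\<^sub>R x)"
  shows "P x"
proof -
  have word: "P (prod_list (map gen vs))" for vs
    by (induction vs) (simp_all add: assms(1,2))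
  have "x \<in> span (range (\<lambda>vs. prod_list (map gen vs)))" by (simp only: generated UNIV_I)
  then show ?thesis
  proof (induction rule: span_induct_alt)
    case base
    show ?case using assms(4) [OF assms(1), of 0] by simp
  qed (auto intro: assms(3,4) word)
qed

lemma subspace_homogeneous: "subspace (homogeneous i)"
  unfolding homogeneous_def by (rule subspace_span)

lemma one_homogeneous: "1 \<in> homogeneous 0"
  unfolding homogeneous_def by (rule span_base) simp

lemma gen_mult_homogeneous:
  assumes "x \<in> homogeneous i"
  shows "gen v * x \<in> homogeneous (Suc i)"
proof -
  have "(\<lambda>u. gen v * u) ` {prod_list (map gen vs) | vs. length vs = i}
      \<subseteq> {prod_list (map gen vs) | vs. length vs = Suc i}"
  proof clarify
    fix vs :: "'v list"
    show "\<exists>ws. gen v * prod_list (map gen vs) = prod_list (map gen ws) \<and> length ws = Suc (length vs)"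
      by (rule exI [of _ "v # vs"]) simp
  qed
  from span_mono [OF this] assms show ?thesis
    unfolding homogeneous_def linear_span_image [OF linear_mult_left] by blast
qed

lemma homogeneous_induct [consumes 1, case_names one gen add scale]:
  assumes "x \<in> homogeneous i" "P 0 1"
    and "\<And>i v x. x \<in> homogeneous i \<Longrightarrow> P i x \<Longrightarrow> P (Suc i) (gen v * x)"
    and "\<And>i x y. x \<in> homogeneous i \<Longrightarrow> y \<in> homogeneous i \<Longrightarrow> P i x \<Longrightarrow> P i y \<Longrightarrow> P i (x + y)"
    and "\<And>i c x. x \<in> homogeneous i \<Longrightarrow> P i x \<Longrightarrow> P i (c *\<^sub>R x)"
  shows "P i x"
proof -
  have word: "P (length vs) (prod_list (map gen vs)) \<and> prod_list (map gen vs) \<in> homogeneous (length vs)"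
    for vs
    by (induction vs) (simp_all add: assms(2,3) one_homogeneous gen_mult_homogeneous)
  have zero: "P i 0"
    using word [of "replicate i 0"] assms(5) [of _ i 0] by fastforce
  have "P i x \<and> x \<in> homogeneous i"
    using assms(1) unfolding homogeneous_def [of i]
  proof (induction rule: span_induct_alt)
    case base
    show ?case by (simp add: zero span_zero)
  next
    case (step c x y)
    then show ?case
      using word assms(4,5) subspace_homogeneous [of i]
      unfolding homogeneous_def [of i, symmetric]
      by (auto simp: subspace_add subspace_scale)
  qed
  then show ?thesis ..
qed

lemma contraction_homogeneous_0:
  assumes "linear \<alpha>" "x \<in> homogeneous 0"
  shows "contraction \<alpha> x = 0"
proof -
  note lin = linear_contraction [OF assms(1)]
  have "i = 0 \<longrightarrow> contraction \<alpha> x = 0" if "x \<in> homogeneous i" for i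
    using that by (induction rule: homogeneous_induct)
      (simp_all add: contraction_one assms(1) linear_add [OF lin] linear_cmul [OF lin])
  with assms(2) show ?thesis by blast
qed

lemma contraction_homogeneous:
  assumes "linear \<alpha>" "x \<in> homogeneous (Suc i)"
  shows "contraction \<alpha> x \<in> homogeneous i"
proof -
  note lin = linear_contraction [OF assms(1)]
  have "\<forall>i. j = Suc i \<longrightarrow> contraction \<alpha> x \<in> homogeneous i" if "x \<in> homogeneous j" for j
    using that
  proof (induction rule: homogeneous_induct)
    case (gen j v x)
    have "gen v * contraction \<alpha> x \<in> homogeneous j"
    proof (cases j)
      case 0
      then show ?thesis
        using gen.hyps contraction_homogeneous_0 [OF assms(1)] subspace_0 [OF subspace_homogeneous]
        by simp
    qed (use gen.IH gen_mult_homogeneous in blast)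
    then show ?case
      using gen.hyps
      by (auto simp: contraction_gen_mult [OF assms(1)] intro!: subspace_add [OF subspace_homogeneous]
          subspace_scale [OF subspace_homogeneous])
  qed (auto simp: linear_add [OF lin] linear_cmul [OF lin] intro!: subspace_add [OF subspace_homogeneous]
          subspace_scale [OF subspace_homogeneous])
  with assms(2) show ?thesis by blast
qed

text \<open>
  Passing the first vector of a product \<open>v x\<close> costs a factor \<open>\<epsilon>\<close> in the contraction and another
  one for moving \<open>t\<^sub>k\<close> past \<open>v\<close>; since \<open>\<epsilon>\<^sup>2 = 1\<close>, the vector \<open>v\<close> contributes the expansion of
  itself in the basis, once for every factor of the product.
\<close>

lemma euler_identity:
  assumes "is_basis n t" "x \<in> homogeneous i"
  shows "(\<Sum>k=1..n. gen (t k) * contraction (dual_basis n t k) x) = real i *\<^sub>R x"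
  using assms(2)
proof (induction rule: homogeneous_induct)
  case one
  show ?case by (simp add: contraction_one [OF linear_dual_basis [OF assms(1)]])
next
  case (gen i v x)
  have "gen (t k) * contraction (dual_basis n t k) (gen v * x)
      = gen (dual_basis n t k v *\<^sub>R t k) * x + gen v * (gen (t k) * contraction (dual_basis n t k) x)" for k
  proof -
    have "\<epsilon> *\<^sub>R (gen (t k) * (gen v * y)) = gen v * (gen (t k) * y)" for y
      using gen_commute [of "t k" v] sign_square by (simp flip: mult.assoc)
    then show ?thesis
      by (simp add: contraction_gen_mult [OF linear_dual_basis [OF assms(1)]] distrib_left
          linear_cmul [OF linear_gen])
  qed
  then have "(\<Sum>k=1..n. gen (t k) * contraction (dual_basis n t k) (gen v * x))
      = gen (\<Sum>k=1..n. dual_basis n t k v *\<^sub>R t k) * x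
        + gen v * (\<Sum>k=1..n. gen (t k) * contraction (dual_basis n t k) x)"
    by (simp add: sum.distrib sum_distrib_left sum_distrib_right linear_sum [OF linear_gen]
        del: One_nat_def)
  then show ?case
    by (simp add: basis_expansion [OF assms(1)] gen.IH scaleR_add_left del: One_nat_def)
next
  case (add i x y)
  then show ?case
    by (simp add: linear_add [OF linear_contraction [OF linear_dual_basis [OF assms(1)]]]
        distrib_left sum.distrib scaleR_add_right del: One_nat_def)
next
  case (scale i c x)
  then show ?case
    by (simp add: linear_cmul [OF linear_contraction [OF linear_dual_basis [OF assms(1)]]]
        scaleR_left_commute flip: scaleR_sum_right del: One_nat_def)
qed

subsection \<open>Functoriality\<close>

lemma linear_induced: "linear f \<Longrightarrow> linear (induced f)"
  and induced_one: "linear f \<Longrightarrow> induced f 1 = 1"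
  and induced_mult: "linear f \<Longrightarrow> induced f (x * y) = induced f x * induced f y"
  using algebra_hom_induced [of f] by (simp_all add: algebra_hom_def)

lemma induced_homogeneous:
  assumes "linear f" "x \<in> homogeneous i"
  shows "induced f x \<in> homogeneous i"
  using assms(2)
  by (induction rule: homogeneous_induct)
    (simp_all add: induced_one induced_mult induced_gen assms(1) one_homogeneous gen_mult_homogeneous
      linear_add [OF linear_induced] linear_cmul [OF linear_induced]
      subspace_add [OF subspace_homogeneous] subspace_scale [OF subspace_homogeneous])

lemma induced_id:
  assumes "\<And>v. f v = v"
  shows "induced f x = x"
proof -
  have "linear f" using assms by (auto intro: linearI)
  then show ?thesis
    by (induction x rule: generated_induct)
      (simp_all add: induced_one induced_mult induced_gen assms
        linear_add [OF linear_induced] linear_cmul [OF linear_induced])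
qed

lemma induced_compose:
  assumes "linear f" "linear g" "\<And>v. h v = f (g v)"
  shows "induced h x = induced f (induced g x)"
proof -
  have "h = f \<circ> g" using assms(3) by auto
  then have "linear h" using linear_compose [OF assms(2,1)] by simp
  then show ?thesis
    by (induction x rule: generated_induct)
      (simp_all add: induced_one induced_mult induced_gen assms
        linear_add [OF linear_induced] linear_cmul [OF linear_induced])
qed

text \<open>Contraction is linear in the functional, in the form used for a change of basis.\<close>

lemma contraction_sum:
  assumes "\<And>j. j \<in> J \<Longrightarrow> linear (\<beta> j)" "linear \<alpha>" "\<And>v. \<alpha> v = (\<Sum>j\<in>J. c j * \<beta> j v)"
  shows "contraction \<alpha> x = (\<Sum>j\<in>J. c j *\<^sub>R contraction (\<beta> j) x)"
proof (induction x rule: generated_induct)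
  case one
  show ?case by (simp add: contraction_one assms(1,2))
next
  case (gen v x)
  have "contraction \<alpha> (gen v * x)
      = (\<Sum>j\<in>J. c j * \<beta> j v) *\<^sub>R x + \<epsilon> *\<^sub>R (gen v * (\<Sum>j\<in>J. c j *\<^sub>R contraction (\<beta> j) x))"
    by (simp only: contraction_gen_mult [OF assms(2)] gen assms(3) [of v])
  also have "\<dots> = (\<Sum>j\<in>J. c j *\<^sub>R (\<beta> j v *\<^sub>R x + \<epsilon> *\<^sub>R (gen v * contraction (\<beta> j) x)))"
    by (simp add: scaleR_add_right sum.distrib scaleR_sum_right scaleR_sum_left sum_distrib_left
        mult.commute)
  also have "\<dots> = (\<Sum>j\<in>J. c j *\<^sub>R contraction (\<beta> j) (gen v * x))"
    by (simp add: contraction_gen_mult assms(1))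
  finally show ?case .
next
  case (add x y)
  then show ?case
    by (simp add: linear_add [OF linear_contraction] assms(1,2) scaleR_add_right sum.distrib)
next
  case (scale c x)
  then show ?case
    by (simp add: linear_cmul [OF linear_contraction] assms(1,2) scaleR_sum_right mult.commute)
qed

text \<open>
  The induced maps intertwine contraction by \<open>\<alpha>\<close> with contraction by the pullback of \<open>\<alpha>\<close>: both
  sides obey the same recursion.
\<close>

lemma contraction_induced:
  assumes "linear \<alpha>" "linear f"
  shows "contraction \<alpha> (induced f x) = induced f (contraction (\<lambda>v. \<alpha> (f v)) x)"
proof -
  have lin: "linear (\<lambda>v. \<alpha> (f v))"
    using linear_compose [OF assms(2,1)] by (simp add: comp_def)
  show ?thesis
    by (induction x rule: generated_induct)
      (simp_all add: induced_one induced_mult induced_gen assms lin contraction_one contraction_gen_mult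
        linear_add [OF linear_induced] linear_cmul [OF linear_induced] linear_0 [OF linear_induced]
        linear_add [OF linear_contraction] linear_cmul [OF linear_contraction])
qed

subsection \<open>The Lefschetz operators and their commutator\<close>

context
  fixes n :: nat and t :: "nat \<Rightarrow> 'v"
  assumes basis: "is_basis n t"
begin

abbreviation partial :: "nat \<Rightarrow> 'a \<Rightarrow> 'a" (\<open>\<partial>\<close>)
  where "\<partial> k \<equiv> contraction (dual_basis n t k)"

lemma linear_partial: "linear (\<partial> k)"
  by (rule linear_contraction [OF linear_dual_basis [OF basis]])

lemma linear_lefschetz: "linear (lefschetz n t)"
  unfolding lefschetz_def
  by (intro linear_compose_sum ballI linear_tensor_map linear_mult_left linear_partial)

lemma linear_dual_lefschetz: "linear (dual_lefschetz n t)"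
  unfolding dual_lefschetz_def
  by (intro linear_compose_sum ballI linear_tensor_map linear_mult_left linear_partial)

lemma lefschetz_tensor: "lefschetz n t (x \<otimes>\<^sub>\<real> y) = (\<Sum>k=1..n. (gen (t k) * x) \<otimes>\<^sub>\<real> \<partial> k y)"
  unfolding lefschetz_def by (simp only: tensor_map_tensor [OF linear_mult_left linear_partial])

lemma dual_lefschetz_tensor: "dual_lefschetz n t (x \<otimes>\<^sub>\<real> y) = (\<Sum>k=1..n. \<partial> k x \<otimes>\<^sub>\<real> (gen (t k) * y))"
  unfolding dual_lefschetz_def by (simp only: tensor_map_tensor [OF linear_partial linear_mult_left])

lemma lefschetz_degree:
  "lefschetz n t ` tensor_subspace (homogeneous a) (homogeneous (Suc b))
    \<subseteq> tensor_subspace (homogeneous (Suc a)) (homogeneous b)"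
  by (rule linear_image_tensor_subspace [OF linear_lefschetz subspace_tensor_subspace])
    (auto simp: lefschetz_tensor simp del: One_nat_def
      intro!: subspace_sum [OF subspace_tensor_subspace] tensor_in_tensor_subspace
        gen_mult_homogeneous contraction_homogeneous linear_dual_basis [OF basis])

lemma dual_lefschetz_degree:
  "dual_lefschetz n t ` tensor_subspace (homogeneous (Suc a)) (homogeneous b)
    \<subseteq> tensor_subspace (homogeneous a) (homogeneous (Suc b))"
  by (rule linear_image_tensor_subspace [OF linear_dual_lefschetz subspace_tensor_subspace])
    (auto simp: dual_lefschetz_tensor simp del: One_nat_def
      intro!: subspace_sum [OF subspace_tensor_subspace] tensor_in_tensor_subspace
        gen_mult_homogeneous contraction_homogeneous linear_dual_basis [OF basis])

lemma dual_lefschetz_degree_0: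
  assumes "z \<in> tensor_subspace (homogeneous 0) (homogeneous b)"
  shows "dual_lefschetz n t z = 0"
proof -
  have "dual_lefschetz n t ` tensor_subspace (homogeneous 0) (homogeneous b) \<subseteq> {0}"
  proof (rule linear_image_tensor_subspace [OF linear_dual_lefschetz])
    fix x y assume "x \<in> homogeneous 0"
    then show "dual_lefschetz n t (x \<otimes>\<^sub>\<real> y) \<in> {0}"
      by (simp add: dual_lefschetz_tensor tensor_zero_left
          contraction_homogeneous_0 [OF linear_dual_basis [OF basis]])
  qed (simp add: subspace_def)
  with assms show ?thesis by blast
qed

text \<open>
  On \<open>x \<otimes> y\<close> both composites are double sums over \<open>k\<close> and \<open>l\<close>. The commutation relation produces
  a diagonal part, which is an Euler operator on one factor, and \<open>\<epsilon>\<close> times the same sum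
  \<open>\<Sum>\<^sub>k\<^sub>,\<^sub>l t\<^sub>k \<partial>\<^sub>l x \<otimes> t\<^sub>l \<partial>\<^sub>k y\<close> in both.
\<close>

lemma lefschetz_commutator:
  assumes "z \<in> tensor_subspace (homogeneous a) (homogeneous b)"
  shows "lefschetz n t (dual_lefschetz n t z)
    = dual_lefschetz n t (lefschetz n t z) + (real a - real b) *\<^sub>R z"
proof (rule linear_eq_on_tensor_subspace [OF _ _ _ assms])
  let ?L = "lefschetz n t" and ?M = "dual_lefschetz n t"
  show "linear (\<lambda>z. ?L (?M z))"
    using linear_compose [OF linear_dual_lefschetz linear_lefschetz] by (simp add: comp_def)
  have "linear (\<lambda>z. ?M (?L z))"
    using linear_compose [OF linear_lefschetz linear_dual_lefschetz] by (simp add: comp_def)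
  then show "linear (\<lambda>z. ?M (?L z) + (real a - real b) *\<^sub>R z)"
    by (intro linear_compose_add linear_compose_scale_right linear_ident)
next
  let ?L = "lefschetz n t" and ?M = "dual_lefschetz n t"
  fix x y assume x: "x \<in> homogeneous a" and y: "y \<in> homogeneous b"
  let ?S = "\<Sum>l=1..n. \<Sum>k=1..n. \<epsilon> *\<^sub>R ((gen (t k) * \<partial> l x) \<otimes>\<^sub>\<real> (gen (t l) * \<partial> k y))"
  have rel: "\<partial> k (gen (t l) * u) = (if l = k then u else 0) + \<epsilon> *\<^sub>R (gen (t l) * \<partial> k u)"
    if "k \<in> {1..n}" "l \<in> {1..n}" for k l u
    using dual_basis_apply [OF basis that(2,1)]
    by (simp add: contraction_gen_mult [OF linear_dual_basis [OF basis]] del: One_nat_def)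
  have "?L (?M (x \<otimes>\<^sub>\<real> y)) = (\<Sum>l=1..n. \<Sum>k=1..n. (gen (t k) * \<partial> l x) \<otimes>\<^sub>\<real> \<partial> k (gen (t l) * y))"
    by (simp only: dual_lefschetz_tensor linear_sum [OF linear_lefschetz] lefschetz_tensor)
  also have "\<dots> = (\<Sum>l=1..n. \<Sum>k=1..n. (if l = k then (gen (t k) * \<partial> k x) \<otimes>\<^sub>\<real> y else 0)
      + \<epsilon> *\<^sub>R ((gen (t k) * \<partial> l x) \<otimes>\<^sub>\<real> (gen (t l) * \<partial> k y)))"
    by (intro sum.cong refl) (simp add: rel tensor_add_right tensor_scaleR_right tensor_zero_right del: One_nat_def)
  also have "\<dots> = (\<Sum>k=1..n. gen (t k) * \<partial> k x) \<otimes>\<^sub>\<real> y + ?S"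
    by (simp add: sum.distrib tensor_sum_left del: One_nat_def)
  finally have raise_lower: "?L (?M (x \<otimes>\<^sub>\<real> y)) = real a *\<^sub>R (x \<otimes>\<^sub>\<real> y) + ?S"
    by (simp only: euler_identity [OF basis x] tensor_scaleR_left)
  have "?M (?L (x \<otimes>\<^sub>\<real> y)) = (\<Sum>k=1..n. \<Sum>l=1..n. \<partial> l (gen (t k) * x) \<otimes>\<^sub>\<real> (gen (t l) * \<partial> k y))"
    by (simp only: lefschetz_tensor linear_sum [OF linear_dual_lefschetz] dual_lefschetz_tensor)
  also have "\<dots> = (\<Sum>k=1..n. \<Sum>l=1..n. (if k = l then x \<otimes>\<^sub>\<real> (gen (t k) * \<partial> k y) else 0)
      + \<epsilon> *\<^sub>R ((gen (t k) * \<partial> l x) \<otimes>\<^sub>\<real> (gen (t l) * \<partial> k y)))"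
    by (intro sum.cong refl) (simp add: rel tensor_add_left tensor_scaleR_left tensor_zero_left del: One_nat_def)
  also have "\<dots> = x \<otimes>\<^sub>\<real> (\<Sum>k=1..n. gen (t k) * \<partial> k y) + ?S"
  proof -
    have "(\<Sum>k=1..n. \<Sum>l=1..n. \<epsilon> *\<^sub>R ((gen (t k) * \<partial> l x) \<otimes>\<^sub>\<real> (gen (t l) * \<partial> k y))) = ?S"
      by (rule sum.swap)
    then show ?thesis
      by (simp add: sum.distrib tensor_sum_right del: One_nat_def)
  qed
  finally have lower_raise: "?M (?L (x \<otimes>\<^sub>\<real> y)) = real b *\<^sub>R (x \<otimes>\<^sub>\<real> y) + ?S"
    by (simp only: euler_identity [OF basis y] tensor_scaleR_right)
  show "?L (?M (x \<otimes>\<^sub>\<real> y)) = ?M (?L (x \<otimes>\<^sub>\<real> y)) + (real a - real b) *\<^sub>R (x \<otimes>\<^sub>\<real> y)"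
    unfolding raise_lower lower_raise by (simp add: algebra_simps)
qed

text \<open>
  Eigenvectors rather than only the kernel of \<open>L\<close> make the induction on \<open>a\<close> work: if \<open>ML z = -c z\<close>,
  then by the commutator \<open>LM z = -(c + b - a) z\<close>, so \<open>M z\<close> is again such an eigenvector, in bidegree
  \<open>(a - 1, b + 1)\<close> and with the larger constant \<open>c + b - a\<close>. Hence \<open>M z = 0\<close>, and therefore
  \<open>(c + b - a) z = -LM z = 0\<close>.
\<close>

lemma no_nonpositive_eigenvalue:
  assumes "z \<in> tensor_subspace (homogeneous a) (homogeneous b)" "a < b" "0 \<le> c"
    and "dual_lefschetz n t (lefschetz n t z) = - c *\<^sub>R z"
  shows "z = 0"
  using assms
proof (induction a arbitrary: b c z)
  let ?L = "lefschetz n t" and ?M = "dual_lefschetz n t"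
  have step: "z = 0"
    if z: "z \<in> tensor_subspace (homogeneous a) (homogeneous b)" and "a < b" "0 \<le> c"
      and eig: "?M (?L z) = - c *\<^sub>R z" and M0: "?M z = 0" for a b c z
  proof -
    have "(real a - real b - c) *\<^sub>R z = 0"
      using lefschetz_commutator [OF z] unfolding M0 eig linear_0 [OF linear_lefschetz]
      by (simp add: algebra_simps)
    with that(2,3) show ?thesis by simp
  qed
  {
    case 0
    then show ?case using step dual_lefschetz_degree_0 by blast
  next
    case (Suc a)
    define c' where "c' = c + real b - real (Suc a)"
    have "?L (?M z) = - c' *\<^sub>R z"
      unfolding lefschetz_commutator [OF Suc.prems(1)] Suc.prems(4) c'_def by (simp add: algebra_simps)
    then have "?M (?L (?M z)) = - c' *\<^sub>R ?M z"
      by (simp only: linear_cmul [OF linear_dual_lefschetz])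
    moreover have "?M z \<in> tensor_subspace (homogeneous a) (homogeneous (Suc b))"
      using dual_lefschetz_degree Suc.prems(1) by blast
    ultimately have "?M z = 0"
      using Suc.IH [of "?M z" "Suc b" c'] Suc.prems(2,3) by (simp add: c'_def)
    with step [OF Suc.prems] show ?case .
  }
qed

lemma inj_on_lefschetz:
  assumes "a < b"
  shows "inj_on (lefschetz n t) (tensor_subspace (homogeneous a) (homogeneous b))"
  unfolding linear_inj_on_iff_eq_0 [OF linear_lefschetz subspace_tensor_subspace]
  using no_nonpositive_eigenvalue [OF _ assms, of _ 0]
  by (auto simp: linear_0 [OF linear_dual_lefschetz])

subsection \<open>Equivariance\<close>

text \<open>
  Contracting \<open>f y\<close> pulls the functional \<open>t\<^sub>k\<^sup>*\<close> back to \<open>\<Sum>\<^sub>j t\<^sub>k\<^sup>*(f t\<^sub>j) t\<^sub>j\<^sup>*\<close>. Moving these coefficients to the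
  first factor and summing over \<open>k\<close> first turns \<open>t\<^sub>k\<close> into \<open>f t\<^sub>j\<close>.
\<close>

lemma lefschetz_natural:
  assumes "linear f"
  shows "lefschetz n t (tensor_map (induced f) (induced f) z)
    = tensor_map (induced f) (induced f) (lefschetz n t z)"
proof (rule linear_eq_on_tensor_subspace [where U = UNIV and W = UNIV and z = z
      and h = "\<lambda>z. lefschetz n t (tensor_map (induced f) (induced f) z)"
      and h' = "\<lambda>z. tensor_map (induced f) (induced f) (lefschetz n t z)"])
  let ?L = "lefschetz n t" and ?F = "tensor_map (induced f) (induced f)"
  note lin = linear_induced [OF assms]
  note linF = linear_tensor_map [OF lin lin]
  show "linear (\<lambda>z. ?L (?F z))"
    using linear_compose [OF linF linear_lefschetz] by (simp add: comp_def)
  show "linear (\<lambda>z. ?F (?L z))"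
    using linear_compose [OF linear_lefschetz linF] by (simp add: comp_def)
  fix x y :: 'a
  let ?c = "\<lambda>k j. dual_basis n t k (f (t j))"
  have D: "\<partial> k (induced f y) = (\<Sum>j=1..n. ?c k j *\<^sub>R induced f (\<partial> j y))" for k
  proof -
    have "linear (\<lambda>v. dual_basis n t k (f v))"
      using linear_compose [OF assms linear_dual_basis [OF basis]] by (simp add: comp_def)
    then have "contraction (\<lambda>v. dual_basis n t k (f v)) y = (\<Sum>j=1..n. ?c k j *\<^sub>R \<partial> j y)"
      by (rule contraction_sum [OF linear_dual_basis [OF basis]])
        (rule dual_basis_compose [OF basis assms])
    then show ?thesis
      by (simp only: contraction_induced [OF linear_dual_basis [OF basis] assms]
          linear_sum [OF lin] linear_cmul [OF lin])
  qed
  have gen_f: "(\<Sum>k=1..n. ?c k j *\<^sub>R gen (t k)) = gen (f (t j))" for j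
    by (simp only: basis_expansion [OF basis] flip: linear_cmul [OF linear_gen] linear_sum [OF linear_gen])
  have "?L (?F (x \<otimes>\<^sub>\<real> y))
      = (\<Sum>k=1..n. \<Sum>j=1..n. ((?c k j *\<^sub>R gen (t k)) * induced f x) \<otimes>\<^sub>\<real> induced f (\<partial> j y))"
    by (simp add: tensor_map_tensor [OF lin lin] lefschetz_tensor D tensor_sum_right
        tensor_scaleR_left tensor_scaleR_right del: One_nat_def)
  also have "\<dots> = (\<Sum>j=1..n. ((\<Sum>k=1..n. ?c k j *\<^sub>R gen (t k)) * induced f x) \<otimes>\<^sub>\<real> induced f (\<partial> j y))"
    by (subst sum.swap) (simp only: sum_distrib_right tensor_sum_left)
  also have "\<dots> = ?F (?L (x \<otimes>\<^sub>\<real> y))"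
    by (simp only: gen_f lefschetz_tensor linear_sum [OF linF] tensor_map_tensor [OF lin lin]
        induced_mult [OF assms] induced_gen [OF assms])
  finally show "?L (?F (x \<otimes>\<^sub>\<real> y)) = ?F (?L (x \<otimes>\<^sub>\<real> y))" .
qed (simp add: tensor_subspace_UNIV)

subsection \<open>Equivariant log-concavity\<close>

text \<open>
  Multiplying the elements of a finite spanning set in degree \<open>i\<close> by the basis vectors of \<open>V\<close> gives
  one in degree \<open>i + 1\<close>.
\<close>

lemma finite_dimensional_homogeneous: "finite_dimensional (homogeneous i)"
proof (induction i)
  case 0
  have "homogeneous 0 = span {1}" unfolding homogeneous_def by simp
  then show ?case unfolding finite_dimensional_def by blast
next
  case (Suc i)
  then obtain B where B: "finite B" "span B = homogeneous i" unfolding finite_dimensional_def by blast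
  let ?C = "(\<lambda>(k, b). gen (t k) * b) ` ({1..n} \<times> B)"
  have mem: "gen v * x \<in> span ?C" if "x \<in> homogeneous i" for v x
  proof -
    have *: "gen (t k) * x \<in> span ?C" if "k \<in> {1..n}" for k
    proof -
      have "gen (t k) * x \<in> span ((\<lambda>u. gen (t k) * u) ` B)"
        unfolding linear_span_image [OF linear_mult_left] B(2) using \<open>x \<in> _\<close> by blast
      moreover have "(\<lambda>u. gen (t k) * u) ` B \<subseteq> ?C" using that by force
      ultimately show ?thesis using span_mono by blast
    qed
    have "gen v * x = gen (\<Sum>k=1..n. dual_basis n t k v *\<^sub>R t k) * x"
      by (simp only: basis_expansion [OF basis])
    also have "\<dots> = (\<Sum>k=1..n. dual_basis n t k v *\<^sub>R (gen (t k) * x))"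
      by (simp add: linear_sum [OF linear_gen] linear_cmul [OF linear_gen] sum_distrib_right
          del: One_nat_def)
    also have "\<dots> \<in> span ?C" by (intro span_sum span_scale *)
    finally show ?thesis .
  qed
  have "span ?C = homogeneous (Suc i)"
  proof
    have "b \<in> homogeneous i" if "b \<in> B" for b using span_base [OF that] B(2) by simp
    then show "span ?C \<subseteq> homogeneous (Suc i)"
      by (intro span_minimal subspace_homogeneous) (auto intro: gen_mult_homogeneous)
    have "prod_list (map gen vs) \<in> span ?C" if len: "length vs = Suc i" for vs
    proof -
      obtain w ws where vs: "vs = w # ws" and ws: "length ws = i" using len by (cases vs) auto
      have "prod_list (map gen ws) \<in> homogeneous i"
        unfolding homogeneous_def by (rule span_base) (use ws in blast)
      then show ?thesis using mem vs by simp
    qed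
    then show "homogeneous (Suc i) \<subseteq> span ?C"
      unfolding homogeneous_def by (intro span_minimal subspace_span) blast
  qed
  then show ?case unfolding finite_dimensional_def using B(1) by (intro exI [of _ ?C]) simp
qed

lemma group_representation_homogeneous:
  assumes "group_representation G UNIV \<rho>"
  shows "group_representation G (homogeneous i) (\<lambda>g. induced (\<rho> g))"
  using assms unfolding group_representation_def
  by (auto simp: subspace_homogeneous linear_induced induced_homogeneous induced_id
      intro: induced_compose)

lemma
  assumes "a \<le> b" and rep: "group_representation G UNIV \<rho>"
  defines "U \<equiv> tensor_subspace (homogeneous a) (homogeneous (Suc b))"
    and "W \<equiv> tensor_subspace (homogeneous (Suc a)) (homogeneous b)"
    and "\<tau> \<equiv> tensor_action (\<lambda>g. induced (\<rho> g)) (\<lambda>g. induced (\<rho> g))"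
  shows equivariant_lefschetz: "equivariant G U \<tau> \<tau> (lefschetz n t)"
    and subrepresentation_lefschetz: "subrepresentation G W \<tau> (lefschetz n t ` U)"
    and isomorphic_lefschetz: "isomorphic_representations G U \<tau> (lefschetz n t ` U) \<tau>"
proof -
  have lin: "linear (\<rho> g)" if "g \<in> carrier G" for g
    using rep that by (simp add: group_representation_def)
  show eqv: "equivariant G U \<tau> \<tau> (lefschetz n t)"
    unfolding equivariant_def \<tau>_def tensor_action_def by (simp add: lefschetz_natural lin)
  have "\<tau> g ` U \<subseteq> U" if "g \<in> carrier G" for g
  proof -
    note lin_g = linear_induced [OF lin [OF that]]
    show ?thesis
      unfolding U_def \<tau>_def tensor_action_def
      by (rule linear_image_tensor_subspace [OF linear_tensor_map [OF lin_g lin_g] subspace_tensor_subspace])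
        (simp add: tensor_map_tensor [OF lin_g lin_g] tensor_in_tensor_subspace
          induced_homogeneous [OF lin [OF that]])
  qed
  then have "\<tau> g (lefschetz n t u) \<in> lefschetz n t ` U" if "g \<in> carrier G" "u \<in> U" for g u
    using that eqv by (auto simp: equivariant_def image_subset_iff intro!: image_eqI [of _ _ "\<tau> g u"])
  then have "\<tau> g ` lefschetz n t ` U \<subseteq> lefschetz n t ` U" if "g \<in> carrier G" for g
    using that by blast
  moreover have "lefschetz n t ` U \<subseteq> W"
    unfolding U_def W_def by (rule lefschetz_degree)
  moreover have "subspace (lefschetz n t ` U)"
    unfolding U_def by (rule linear_subspace_image [OF linear_lefschetz subspace_tensor_subspace])
  ultimately show "subrepresentation G W \<tau> (lefschetz n t ` U)"
    by (simp add: subrepresentation_def)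
  show "isomorphic_representations G U \<tau> (lefschetz n t ` U) \<tau>"
    unfolding isomorphic_representations_def
    using linear_lefschetz inj_on_lefschetz [of a "Suc b"] eqv \<open>a \<le> b\<close>
    by (auto simp: U_def bij_betw_def intro!: exI [of _ "lefschetz n t"])
qed

theorem equivariantly_log_concave_homogeneous:
  assumes "group_representation G UNIV \<rho>"
  shows "equivariantly_log_concave G homogeneous (\<lambda>i g. induced (\<rho> g))"
  unfolding equivariantly_log_concave_def
proof (intro conjI allI impI)
  fix i :: nat assume "1 \<le> i"
  then obtain j where i: "i = Suc j" by (cases i) auto
  show "\<exists>S. subrepresentation G (tensor_subspace (homogeneous i) (homogeneous i))
        (tensor_action (\<lambda>g. induced (\<rho> g)) (\<lambda>g. induced (\<rho> g))) S \<and>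
      isomorphic_representations G (tensor_subspace (homogeneous (i - 1)) (homogeneous (i + 1)))
        (tensor_action (\<lambda>g. induced (\<rho> g)) (\<lambda>g. induced (\<rho> g))) S
        (tensor_action (\<lambda>g. induced (\<rho> g)) (\<lambda>g. induced (\<rho> g)))"
    using subrepresentation_lefschetz [OF _ assms, of j i] isomorphic_lefschetz [OF _ assms, of j i]
    unfolding i by auto
qed (use group_representation_homogeneous [OF assms] finite_dimensional_homogeneous in auto)

theorem lefschetz_injective_equivariant:
  assumes "group_representation G UNIV \<rho>" "1 \<le> i"
  shows "let L = lefschetz n t;
            U = tensor_subspace (homogeneous (i - 1)) (homogeneous (i + 1));
            W = tensor_subspace (homogeneous i) (homogeneous i);
            \<tau> = tensor_action (\<lambda>g. induced (\<rho> g)) (\<lambda>g. induced (\<rho> g))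
        in linear L \<and> L ` U \<subseteq> W \<and> inj_on L U \<and> equivariant G U \<tau> \<tau> L"
proof -
  obtain j where i: "i = Suc j" using assms(2) by (cases i) auto
  show ?thesis
    unfolding i Let_def
    using linear_lefschetz lefschetz_degree [of j i] inj_on_lefschetz [of j "Suc i"]
      equivariant_lefschetz [OF _ assms(1), of j i]
    unfolding i by auto
qed

end

end

section \<open>The symmetric and the exterior algebra\<close>

lemma is_derivation_sym_deriv: "linear \<alpha> \<Longrightarrow> is_derivation \<alpha> (sym_deriv \<alpha>)"
  unfolding sym_deriv_def by (rule theI' [OF sym_deriv_ex1])

lemma is_interior_product_interior_product:
  "linear \<alpha> \<Longrightarrow> is_interior_product \<alpha> (interior_product \<alpha>)"
  unfolding interior_product_def by (rule theI' [OF interior_product_ex1])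

lemma ext_gen_anticommute: "ext_gen v * ext_gen w = - (ext_gen w * ext_gen v)"
proof -
  have "ext_gen (v + w) * ext_gen (v + w) = ext_gen v * ext_gen w + ext_gen w * ext_gen v"
    by (simp add: linear_add [OF linear_ext_gen] distrib_left distrib_right ext_gen_square)
  then show ?thesis by (simp add: ext_gen_square eq_neg_iff_add_eq_0)
qed

interpretation sym: contraction_algebra 1 "sym_gen :: 'v::real_vector \<Rightarrow> _" sym_deriv sym_map
  rewrites "contraction_algebra.homogeneous (sym_gen :: 'v \<Rightarrow> _) = sym_power"
    and "contraction_algebra.lefschetz (sym_gen :: 'v \<Rightarrow> _) sym_deriv = sym_lefschetz"
proof -
  show *: "contraction_algebra 1 sym_gen sym_deriv (sym_map :: ('v \<Rightarrow> 'v::real_vector) \<Rightarrow> _)"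
  proof (rule contraction_algebra.intro)
    have "x \<in> span (range (\<lambda>vs. prod_list (map sym_gen vs)))" for x :: "'v sym_algebra"
      by (induction x rule: sym_algebra_induct) (auto intro: span_base span_add span_scale)
    then show "span (range (\<lambda>vs. prod_list (map sym_gen vs))) = (UNIV :: 'v sym_algebra set)" by blast
  next
    fix \<alpha> :: "'v \<Rightarrow> real" assume "linear \<alpha>"
    then have D: "linear (sym_deriv \<alpha>)" "\<And>v. sym_deriv \<alpha> (sym_gen v) = of_real (\<alpha> v)"
      "\<And>x y. sym_deriv \<alpha> (x * y) = sym_deriv \<alpha> x * y + x * sym_deriv \<alpha> y"
      using is_derivation_sym_deriv unfolding is_derivation_def by blast+
    show "linear (sym_deriv \<alpha>)" by (rule D)
    show "sym_deriv \<alpha> 1 = 0" using D(3) [of 1 1] by simp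
    show "sym_deriv \<alpha> (sym_gen v * x) = \<alpha> v *\<^sub>R x + 1 *\<^sub>R (sym_gen v * sym_deriv \<alpha> x)" for v x
      by (simp add: D scaleR_conv_of_real)
  qed (simp_all add: linear_sym_gen algebra_hom_sym_map sym_map_gen mult.commute)
  show "contraction_algebra.homogeneous sym_gen = (sym_power :: nat \<Rightarrow> 'v sym_algebra set)"
    by (simp add: fun_eq_iff contraction_algebra.homogeneous_def [OF *] sym_power_def)
  show "contraction_algebra.lefschetz sym_gen sym_deriv
      = (sym_lefschetz :: nat \<Rightarrow> (nat \<Rightarrow> 'v) \<Rightarrow> _)"
    by (simp add: fun_eq_iff contraction_algebra.lefschetz_def [OF *] sym_lefschetz_def)
qed

interpretation ext: contraction_algebra "-1" "ext_gen :: 'v::real_vector \<Rightarrow> _" interior_product ext_map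
  rewrites "contraction_algebra.homogeneous (ext_gen :: 'v \<Rightarrow> _) = ext_power"
    and "contraction_algebra.lefschetz (ext_gen :: 'v \<Rightarrow> _) interior_product = ext_lefschetz"
proof -
  show *: "contraction_algebra (-1) ext_gen interior_product (ext_map :: ('v \<Rightarrow> 'v::real_vector) \<Rightarrow> _)"
  proof (rule contraction_algebra.intro)
    have "x \<in> span (range (\<lambda>vs. prod_list (map ext_gen vs)))" for x :: "'v ext_algebra"
      by (induction x rule: ext_algebra_induct) (auto intro: span_base span_add span_scale)
    then show "span (range (\<lambda>vs. prod_list (map ext_gen vs))) = (UNIV :: 'v ext_algebra set)" by blast
    show "ext_gen v * ext_gen w = (-1) *\<^sub>R (ext_gen w * ext_gen v)" for v w :: 'v
      using ext_gen_anticommute [of v w] by simp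
  next
    fix \<alpha> :: "'v \<Rightarrow> real" assume "linear \<alpha>"
    then have D: "linear (interior_product \<alpha>)" "\<And>v. interior_product \<alpha> (ext_gen v) = of_real (\<alpha> v)"
      "\<And>c. interior_product \<alpha> (of_real c) = 0"
      "\<And>p u w. u \<in> ext_power p \<Longrightarrow>
        interior_product \<alpha> (u * w) = interior_product \<alpha> u * w + (-1) ^ p * (u * interior_product \<alpha> w)"
      using is_interior_product_interior_product unfolding is_interior_product_def by blast+
    show "linear (interior_product \<alpha>)" by (rule D)
    show "interior_product \<alpha> 1 = 0" using D(3) [of 1] by simp
    have "ext_gen v \<in> ext_power 1" for v :: 'v
      unfolding ext_power_def by (rule span_base, rule CollectI, rule exI [of _ "[v]"]) simp
    then show "interior_product \<alpha> (ext_gen v * x)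
        = \<alpha> v *\<^sub>R x + (-1) *\<^sub>R (ext_gen v * interior_product \<alpha> x)" for v x
      using D(4) [of "ext_gen v" 1 x] by (simp add: D(2) scaleR_conv_of_real)
  qed (simp_all add: linear_ext_gen algebra_hom_ext_map ext_map_gen)
  show "contraction_algebra.homogeneous ext_gen = (ext_power :: nat \<Rightarrow> 'v ext_algebra set)"
    by (simp add: fun_eq_iff contraction_algebra.homogeneous_def [OF *] ext_power_def)
  show "contraction_algebra.lefschetz ext_gen interior_product
      = (ext_lefschetz :: nat \<Rightarrow> (nat \<Rightarrow> 'v) \<Rightarrow> _)"
    by (simp add: fun_eq_iff contraction_algebra.lefschetz_def [OF *] ext_lefschetz_def)
qed

theorem corollary2:
  fixes G :: "('g, 'm) monoid_scheme"
    and \<rho> :: "'g \<Rightarrow> 'v::real_vector \<Rightarrow> 'v"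
    and n :: nat and t :: "nat \<Rightarrow> 'v"
  assumes "group_representation G UNIV \<rho>" and "is_basis n t"
  shows "equivariantly_log_concave G sym_power (\<lambda>i g. sym_map (\<rho> g)) \<and>
     equivariantly_log_concave G ext_power (\<lambda>i g. ext_map (\<rho> g)) \<and>
     (\<forall>i\<ge>1.
       (let L = sym_lefschetz n t;
            U = tensor_subspace (sym_power (i - 1)) (sym_power (i + 1));
            W = tensor_subspace (sym_power i) (sym_power i);
            \<tau> = tensor_action (\<lambda>g. sym_map (\<rho> g)) (\<lambda>g. sym_map (\<rho> g))
        in linear L \<and> L ` U \<subseteq> W \<and> inj_on L U \<and> equivariant G U \<tau> \<tau> L) \<and>
       (let L = ext_lefschetz n t;
            U = tensor_subspace (ext_power (i - 1)) (ext_power (i + 1));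
            W = tensor_subspace (ext_power i) (ext_power i);
            \<tau> = tensor_action (\<lambda>g. ext_map (\<rho> g)) (\<lambda>g. ext_map (\<rho> g))
        in linear L \<and> L ` U \<subseteq> W \<and> inj_on L U \<and> equivariant G U \<tau> \<tau> L))"
  using sym.equivariantly_log_concave_homogeneous [OF assms(2,1)]
    ext.equivariantly_log_concave_homogeneous [OF assms(2,1)]
    sym.lefschetz_injective_equivariant [OF assms(2,1)]
    ext.lefschetz_injective_equivariant [OF assms(2,1)]
  by blast

end
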